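(* A depth-first search (DFS) of a directed or undirected graph $G=(V,E)$ with $n$ vertices and $m$ edges can be carried out in $O(n+m)$ time with at most any of the following numbers of bits of working memory: (a) $n+L_{-1}(G)+O(\log n)$; (b) $n+m+O(\log n)$; (c) $n\log(2+8m/n)+O(\log n)$. Here $L_{-1}(G)=\sum_{v\in V,\ d_v\ge 3}\lceil\log_2(d_v-1)\rceil$, where $d_v$ is the (total) degree of $v$ in $G$.
   Context: $\log$ denotes $\log_2$. The total degree of a vertex of a directed graph is its indegree plus its outdegree. Model of computation: word RAM with word length $\Omega(\log n)$ bits and constant-time standard word operations; the input is read-only, the output (if any) is write-only, and space is the number of bits of working memory, not counting input and output. Input representation: $V=\{1,\ldots,n\}$ for a known integer $n\ge 1$. For an undirected graph, the constant-time access functions are: $\mathrm{deg}(u)$, the degree of $u\in V$; for $u\in V$ and $i\in\{0,\ldots,\mathrm{deg}(u)-1\}$, $\mathrm{head}(u,i)$, the $(i+1)$st neighbor $v$ of $u$ in some arbitrary fixed ordering of the neighbors of $u$, and $\mathrm{mate}(u,i)$, the integer $j$ with $\mathrm{head}(v,j)=u$. A directed graph is represented with in/out adjacency arrays, i.e., the inneighbors as well as the outneighbors of each vertex can be accessed one by one, and there are cross links: for each edge $(u,v)$, the function $\mathrm{mate}$ maps in constant time the position of $v$ in the adjacency array of $u$ to that of $u$ in the adjacency array of $v$ and vice versa. A DFS visits all vertices and edges of $G$. Vertices are initially white, become gray when discovered, and turn black when all their incident edges (outgoing edges, if $G$ is directed) have been explored. At the outermost level the DFS steps through the vertices in some order (the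 root order) and starts a new tree at each vertex not yet discovered. It obeys the DFS rule: whenever two or more discovered vertices have unexplored incident (out)edges, an (out)edge incident on the most recently discovered such vertex (the current vertex) is explored first; if it leads to a white vertex $w$, then $w$ is discovered and becomes the current vertex. Carrying out a DFS means executing such a traversal, invoking user procedures at the appropriate events (a vertex turning gray or black; exploration of an edge from the current vertex, distinguishing whether or not it leads to a new vertex; withdrawal over a tree edge). The resources of the user procedures themselves are not counted. *)

theory Defs
  imports Complex_Main
begin

text \<open>
  A call of a user procedure is an event. The edge that the procedure is told about is given as
  a pair (u, i): the edge explored from u that leads to the vertex in position i (counted from 0)
  of the adjacency array of u. \<open>Explore_New\<close> means that this vertex is white at that
  moment, \<open>Explore_Old\<close> that it is not. \<open>Withdraw\<close> refers to a tree edge by the same pair by which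
  it was explored.
\<close>

datatype vertex_event = Discover | Finish
datatype edge_event = Explore_New | Explore_Old | Withdraw
datatype event = At_Vertex vertex_event nat | At_Edge edge_event nat nat

text \<open>
  Programs are structured: straight-line instructions, conditionals and loops in place of jumps.
  As only the existence of programs is ever claimed, this restriction is harmless.
  Operands are registers; a program uses a fixed finite set of registers, which belong to
  the working memory and are charged for. All other memory words are addressed by the contents
  of registers. All working memory is initially 0.

  The input can be inspected only through \<open>Get_Size\<close> (the number n of vertices) and \<open>Access\<close>,
  whose queries are those of the access functions deg, head and mate. The type parameter
  distinguishes the families of adjacency arrays: for directed graphs there is one
  of out-arrays and one of in-arrays, for undirected graphs just one.
\<close>

datatype binop = Add | Sub | Mult | Div | Shl | Shr | And | Or | Xor

datatype 'side query = Deg 'side | Head 'side | Mate 'side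

datatype 'side instr =
    Const nat nat
  | Move nat nat
  | Op binop nat nat nat
  | Load nat nat
  | Store nat nat
  | Get_Size nat
  | Access "'side query" nat nat nat
  | Invoke_Vertex vertex_event nat
  | Invoke_Edge edge_event nat nat

datatype test = Eq nat nat | Less nat nat

datatype 'side com =
    Do "'side instr"
  | Seq "'side com" "'side com"
  | Cond test "'side com" "'side com"
  | While test "'side com"

fun instr_registers :: "'side instr \<Rightarrow> nat set" where
  "instr_registers (Const r c) = {r}"
| "instr_registers (Move r a) = {r, a}"
| "instr_registers (Op f r a b) = {r, a, b}"
| "instr_registers (Load r a) = {r, a}"
| "instr_registers (Store a r) = {a, r}"
| "instr_registers (Get_Size r) = {r}"
| "instr_registers (Access q r a b) = {r, a, b}"
| "instr_registers (Invoke_Vertex k a) = {a}"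
| "instr_registers (Invoke_Edge k a b) = {a, b}"

fun test_registers :: "test \<Rightarrow> nat set" where
  "test_registers (Eq a b) = {a, b}"
| "test_registers (Less a b) = {a, b}"

fun registers :: "'side com \<Rightarrow> nat set" where
  "registers (Do i) = instr_registers i"
| "registers (Seq c d) = registers c \<union> registers d"
| "registers (Cond t c d) = test_registers t \<union> registers c \<union> registers d"
| "registers (While t c) = test_registers t \<union> registers c"

text \<open>
  The word length is \<open>word_length\<close>; all arithmetic is modulo 2 to the power of \<open>word_length\<close>.
  The three remaining numbers delimit the part of the machine that a computation may use:
  the words with addresses less than \<open>mem_words\<close>, only the \<open>mem_bits\<close> low-order bits of each of
  them, and only the \<open>reg_bits\<close> low-order bits of each register. An attempt to go beyond these
  limits leaves the machine stuck. The word length may be much larger than log n, so charging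
  for full words would defeat a space bound with an additive term of O(log n) bits.
\<close>

record machine =
  word_length :: nat
  mem_words :: nat
  mem_bits :: nat
  reg_bits :: nat

definition working_bits :: "machine \<Rightarrow> 'side com \<Rightarrow> nat" where
  "working_bits M P = mem_words M * mem_bits M + card (registers P) * reg_bits M"

record 'side input =
  size_of :: nat
  access :: "'side query \<Rightarrow> nat \<Rightarrow> nat \<Rightarrow> nat option"

record state =
  reg :: "nat \<Rightarrow> nat"
  mem :: "nat \<Rightarrow> nat"

definition initial_state :: state where
  "initial_state = \<lparr>reg = (\<lambda>_. 0), mem = (\<lambda>_. 0)\<rparr>"

fun binop_value :: "nat \<Rightarrow> binop \<Rightarrow> nat \<Rightarrow> nat \<Rightarrow> nat" where
  "binop_value w Add x y = take_bit w (x + y)"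
| "binop_value w Sub x y = take_bit w (x + 2 ^ w - y)"
| "binop_value w Mult x y = take_bit w (x * y)"
| "binop_value w Div x y = x div y"
| "binop_value w Shl x y = take_bit w (push_bit y x)"
| "binop_value w Shr x y = drop_bit y x"
| "binop_value w And x y = Bit_Operations.and x y"
| "binop_value w Or x y = Bit_Operations.or x y"
| "binop_value w Xor x y = Bit_Operations.xor x y"

definition set_reg :: "machine \<Rightarrow> nat \<Rightarrow> nat \<Rightarrow> state \<Rightarrow> state option" where
  "set_reg M r x s =
    (let y = take_bit (word_length M) x
     in if y < 2 ^ reg_bits M then Some (s\<lparr>reg := (reg s)(r := y)\<rparr>) else None)"

fun instr_result :: "machine \<Rightarrow> 'side input \<Rightarrow> 'side instr \<Rightarrow> state \<Rightarrow> state option" where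
  "instr_result M I (Const r c) s = set_reg M r c s"
| "instr_result M I (Move r a) s = set_reg M r (reg s a) s"
| "instr_result M I (Op f r a b) s =
     set_reg M r (binop_value (word_length M) f (reg s a) (reg s b)) s"
| "instr_result M I (Load r a) s =
     (if reg s a < mem_words M then set_reg M r (mem s (reg s a)) s else None)"
| "instr_result M I (Store a r) s =
     (if reg s a < mem_words M \<and> reg s r < 2 ^ mem_bits M
      then Some (s\<lparr>mem := (mem s)(reg s a := reg s r)\<rparr>) else None)"
| "instr_result M I (Get_Size r) s = set_reg M r (size_of I) s"
| "instr_result M I (Access q r a b) s =
     Option.bind (access I q (reg s a) (reg s b)) (\<lambda>x. set_reg M r x s)"
| "instr_result M I (Invoke_Vertex k a) s = Some s"
| "instr_result M I (Invoke_Edge k a b) s = Some s"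

fun instr_events :: "'side instr \<Rightarrow> state \<Rightarrow> event list" where
  "instr_events (Invoke_Vertex k a) s = [At_Vertex k (reg s a)]"
| "instr_events (Invoke_Edge k a b) s = [At_Edge k (reg s a) (reg s b)]"
| "instr_events _ s = []"

fun test_value :: "test \<Rightarrow> state \<Rightarrow> bool" where
  "test_value (Eq a b) s \<longleftrightarrow> reg s a = reg s b"
| "test_value (Less a b) s \<longleftrightarrow> reg s a < reg s b"

text \<open>
  \<open>exec M I c s es t s'\<close>: on input I, the program c started in state s halts in state s'
  after t steps, having triggered the sequence es of events. Every instruction and every
  evaluation of a test is one step.
\<close>

inductive exec ::
  "machine \<Rightarrow> 'side input \<Rightarrow> 'side com \<Rightarrow> state \<Rightarrow> event list \<Rightarrow> nat \<Rightarrow> state \<Rightarrow> bool"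
  for M :: machine and I :: "'side input"
where
  exec_Do: "instr_result M I i s = Some s' \<Longrightarrow> exec M I (Do i) s (instr_events i s) 1 s'"
| exec_Seq: "exec M I c s es t s' \<Longrightarrow> exec M I d s' es' t' s'' \<Longrightarrow>
    exec M I (Seq c d) s (es @ es') (t + t') s''"
| exec_Cond_True: "test_value b s \<Longrightarrow> exec M I c s es t s' \<Longrightarrow> exec M I (Cond b c d) s es (1 + t) s'"
| exec_Cond_False: "\<not> test_value b s \<Longrightarrow> exec M I d s es t s' \<Longrightarrow> exec M I (Cond b c d) s es (1 + t) s'"
| exec_While_False: "\<not> test_value b s \<Longrightarrow> exec M I (While b c) s [] 1 s"
| exec_While_True: "test_value b s \<Longrightarrow> exec M I c s es t s' \<Longrightarrow>
    exec M I (While b c) s' es' t' s'' \<Longrightarrow>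
    exec M I (While b c) s (es @ es') (1 + t + t') s''"

definition undirected_graph :: "nat \<Rightarrow> nat set set \<Rightarrow> bool" where
  "undirected_graph n E \<longleftrightarrow> 1 \<le> n \<and> (\<forall>e\<in>E. e \<subseteq> {1..n} \<and> card e = 2)"

definition undirected_degree :: "nat set set \<Rightarrow> nat \<Rightarrow> nat" where
  "undirected_degree E v = card {e \<in> E. v \<in> e}"

definition directed_graph :: "nat \<Rightarrow> (nat \<times> nat) set \<Rightarrow> bool" where
  "directed_graph n E \<longleftrightarrow> 1 \<le> n \<and> E \<subseteq> {1..n} \<times> {1..n}"

definition total_degree :: "(nat \<times> nat) set \<Rightarrow> nat \<Rightarrow> nat" where
  "total_degree E v = card {u. (u, v) \<in> E} + card {u. (v, u) \<in> E}"

definition L_minus_1 :: "nat \<Rightarrow> (nat \<Rightarrow> nat) \<Rightarrow> int" where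
  "L_minus_1 n d = (\<Sum>v \<in> {v \<in> {1..n}. d v \<ge> 3}. \<lceil>log 2 (real (d v) - 1)\<rceil>)"

definition undirected_arrays :: "nat \<Rightarrow> nat set set \<Rightarrow> (nat \<Rightarrow> nat list) \<Rightarrow> bool" where
  "undirected_arrays n E adj \<longleftrightarrow>
    (\<forall>u\<in>{1..n}. distinct (adj u) \<and> set (adj u) = {v. {u, v} \<in> E})"

datatype side = Out | In

fun opposite :: "side \<Rightarrow> side" where
  "opposite Out = In"
| "opposite In = Out"

definition directed_arrays :: "nat \<Rightarrow> (nat \<times> nat) set \<Rightarrow> (side \<Rightarrow> nat \<Rightarrow> nat list) \<Rightarrow> bool" where
  "directed_arrays n E A \<longleftrightarrow>
    (\<forall>u\<in>{1..n}. distinct (A Out u) \<and> set (A Out u) = {v. (u, v) \<in> E} \<and>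
                distinct (A In u) \<and> set (A In u) = {v. (v, u) \<in> E})"

text \<open>
  If v is in position i of the array of u, mate yields the position of u in the array of v
  (for directed graphs, in the array of v of the opposite kind). The second argument of a
  degree query is ignored. Queries outside of the domain of an access function have no answer.
\<close>

fun array_access ::
  "nat \<Rightarrow> ('side \<Rightarrow> 'side) \<Rightarrow> ('side \<Rightarrow> nat \<Rightarrow> nat list) \<Rightarrow> 'side query \<Rightarrow> nat \<Rightarrow> nat \<Rightarrow> nat option"
where
  "array_access n opp A (Deg x) u i =
     (if u \<in> {1..n} then Some (length (A x u)) else None)"
| "array_access n opp A (Head x) u i =
     (if u \<in> {1..n} \<and> i < length (A x u) then Some (A x u ! i) else None)"
| "array_access n opp A (Mate x) u i =
     (if u \<in> {1..n} \<and> i < length (A x u)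
      then Some (THE j. j < length (A (opp x) (A x u ! i)) \<and> A (opp x) (A x u ! i) ! j = u)
      else None)"

definition undirected_input :: "nat \<Rightarrow> (nat \<Rightarrow> nat list) \<Rightarrow> unit input" where
  "undirected_input n adj = \<lparr>size_of = n, access = array_access n id (\<lambda>_. adj)\<rparr>"

definition directed_input :: "nat \<Rightarrow> (side \<Rightarrow> nat \<Rightarrow> nat list) \<Rightarrow> side input" where
  "directed_input n A = \<lparr>size_of = n, access = array_access n opposite A\<rparr>"

text \<open>
  \<open>discovered\<close> lists the discovered vertices, the most recently discovered one first;
  white vertices are those not in the list, gray ones those in the list that are not black.
  \<open>tree_edge\<close> maps a vertex that is not a root to the edge over which it was discovered.
\<close>

record dfs_state =
  discovered :: "nat list"
  explored :: "(nat \<times> nat) set"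
  black :: "nat set"
  tree_edge :: "nat \<Rightarrow> (nat \<times> nat) option"

definition dfs_start :: dfs_state where
  "dfs_start = \<lparr>discovered = [], explored = {}, black = {}, tree_edge = (\<lambda>_. None)\<rparr>"

definition has_unexplored :: "(nat \<Rightarrow> nat list) \<Rightarrow> dfs_state \<Rightarrow> nat \<Rightarrow> bool" where
  "has_unexplored adj s u \<longleftrightarrow> (\<exists>i < length (adj u). (u, i) \<notin> explored s)"

text \<open>
  The DFS rule is the first premise of \<open>dfs_new\<close> and \<open>dfs_old\<close>: the current
  vertex is the most recently discovered vertex with unexplored edges. The second premise
  says that no later-discovered vertex is still waiting to turn black. In \<open>dfs_finish\<close>, a vertex
  turns black when its edges have been explored, where an edge that led to a new vertex
  counts as dealt with only after the withdrawal over it, i.e., all vertices discovered later are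
  black already. The order in which edges of a vertex are explored and the root
  order are arbitrary.

  For a directed graph, \<open>adj\<close> gives the out-arrays. For an undirected graph, every edge
  is explored once from each of its two endpoints.
\<close>

inductive dfs_step ::
  "nat \<Rightarrow> (nat \<Rightarrow> nat list) \<Rightarrow> dfs_state \<Rightarrow> event list \<Rightarrow> dfs_state \<Rightarrow> bool"
  for n :: nat and adj :: "nat \<Rightarrow> nat list"
where
  dfs_root: "set (discovered s) \<subseteq> black s \<Longrightarrow> r \<in> {1..n} \<Longrightarrow> r \<notin> set (discovered s) \<Longrightarrow>
    dfs_step n adj s [At_Vertex Discover r] (s\<lparr>discovered := r # discovered s\<rparr>)"
| dfs_new: "find (has_unexplored adj s) (discovered s) = Some u \<Longrightarrow>
    find (\<lambda>x. x \<notin> black s) (discovered s) = Some u \<Longrightarrow>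
    i < length (adj u) \<Longrightarrow> (u, i) \<notin> explored s \<Longrightarrow>
    adj u ! i = v \<Longrightarrow> v \<notin> set (discovered s) \<Longrightarrow>
    dfs_step n adj s [At_Edge Explore_New u i, At_Vertex Discover v]
      (s\<lparr>discovered := v # discovered s, explored := insert (u, i) (explored s),
         tree_edge := (tree_edge s)(v := Some (u, i))\<rparr>)"
| dfs_old: "find (has_unexplored adj s) (discovered s) = Some u \<Longrightarrow>
    find (\<lambda>x. x \<notin> black s) (discovered s) = Some u \<Longrightarrow>
    i < length (adj u) \<Longrightarrow> (u, i) \<notin> explored s \<Longrightarrow>
    adj u ! i \<in> set (discovered s) \<Longrightarrow>
    dfs_step n adj s [At_Edge Explore_Old u i] (s\<lparr>explored := insert (u, i) (explored s)\<rparr>)"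
| dfs_finish: "find (\<lambda>x. x \<notin> black s) (discovered s) = Some v \<Longrightarrow>
    \<not> has_unexplored adj s v \<Longrightarrow>
    dfs_step n adj s
      (At_Vertex Finish v #
        (case tree_edge s v of None \<Rightarrow> [] | Some (u, i) \<Rightarrow> [At_Edge Withdraw u i]))
      (s\<lparr>black := insert v (black s)\<rparr>)"

inductive dfs_run ::
  "nat \<Rightarrow> (nat \<Rightarrow> nat list) \<Rightarrow> dfs_state \<Rightarrow> event list \<Rightarrow> dfs_state \<Rightarrow> bool"
  for n :: nat and adj :: "nat \<Rightarrow> nat list"
where
  dfs_run_Nil: "dfs_run n adj s [] s"
| dfs_run_snoc: "dfs_run n adj s es s' \<Longrightarrow> dfs_step n adj s' es' s'' \<Longrightarrow>
    dfs_run n adj s (es @ es') s''"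

definition is_DFS :: "nat \<Rightarrow> (nat \<Rightarrow> nat list) \<Rightarrow> event list \<Rightarrow> bool" where
  "is_DFS n adj es \<longleftrightarrow> (\<exists>s. dfs_run n adj dfs_start es s \<and> black s = {1..n})"

definition carries_out_DFS ::
  "'side com \<Rightarrow> nat \<Rightarrow> 'side input \<Rightarrow> (nat \<Rightarrow> nat list) \<Rightarrow> real \<Rightarrow> real \<Rightarrow> bool"
where
  "carries_out_DFS P w I adj time space \<longleftrightarrow>
    (\<exists>M es t s. word_length M = w \<and> exec M I P initial_state es t s \<and>
       is_DFS (size_of I) adj es \<and> real t \<le> time \<and> real (working_bits M P) \<le> space)"

text \<open>
  One program must work for all graphs, all orders of the adjacency arrays and all sufficiently
  large word lengths. The constants ct, cs and cw are those hidden in the O(n + m) time, the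
  O(log n) additional bits of space and the word length of \<open>\<Omega>\<close>(log n). Since log n vanishes for
  n = 1, log (n + 1) is used in its place.
\<close>

definition undirected_DFS_in_space :: "(nat \<Rightarrow> nat set set \<Rightarrow> real) \<Rightarrow> bool" where
  "undirected_DFS_in_space S \<longleftrightarrow>
    (\<exists>(P :: unit com) (ct :: real) (cs :: real) (cw :: real).
       \<forall>n E adj w. undirected_graph n E \<longrightarrow> undirected_arrays n E adj \<longrightarrow>
         real w \<ge> cw * log 2 (real n + 1) \<longrightarrow>
         carries_out_DFS P w (undirected_input n adj) adj
           (ct * (real n + real (card E))) (S n E + cs * log 2 (real n + 1)))"

definition directed_DFS_in_space :: "(nat \<Rightarrow> (nat \<times> nat) set \<Rightarrow> real) \<Rightarrow> bool" where
  "directed_DFS_in_space S \<longleftrightarrow>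
    (\<exists>(P :: side com) (ct :: real) (cs :: real) (cw :: real).
       \<forall>n E A w. directed_graph n E \<longrightarrow> directed_arrays n E A \<longrightarrow>
         real w \<ge> cw * log 2 (real n + 1) \<longrightarrow>
         carries_out_DFS P w (directed_input n A) (A Out)
           (ct * (real n + real (card E))) (S n E + cs * log 2 (real n + 1)))"

end

theory Submission
  imports Defs
begin

text \<open>
  The gray vertices of a DFS form a path, and the only data kept about them is a stack of counters.
  A vertex with parent position p explores its incident edges in the cyclic order p + 1, p + 2, ...,
  the edge to the parent coming last, and its counter holds the number of positions remaining
  before p. On the return from a child, the current position of the vertex is supplied by mate, so
  the counter determines p; once exploration has moved past p, the counter is at most d - 2 and
  needs \<open>\<lceil>log (d - 1)\<rceil>\<close> bits. Because a counter is merely decremented, in place at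
  the top of the stack, its updates take amortized constant time, even though a vertex with many
  children is returned to many times. Together with one bit per vertex telling whether it is white,
  this is bound (a), up to one bit for the root, which has no parent. Bound (b) follows from
  \<open>2 \<lceil>log (d - 1)\<rceil> \<le> d\<close>, bound (c) from the concavity of the logarithm.
\<close>

section \<open>Weakest preconditions\<close>

text \<open>The position of the parent is never computed from the counter. A vertex walks on
  cyclically, decrementing after every position whether or not an edge was explored there, and a
  borrow that runs off the end of the counter is itself the test for 0: the walk then moves to the
  parent's position and the counter is popped. In a directed graph the positions are those of the
  out-array followed by those of the in-array; the latter are passed without exploration, which is
  why the total degree counts. A root gets a fictitious last position for its missing parent, so its
  counter may grow by one bit. The stack has no delimiters: the width of a counter follows from the
  degree of its vertex, and the loops over a counter measure it by shifting the number of positions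
  minus 2 down to 0. The correctness proof carries the gray vertices below the current one as a
  ghost list of frames. The time bound is part of the loop invariant: elapsed time plus 30 times a
  potential never exceeds a fixed deadline.\<close>

definition wp ::
  "machine \<Rightarrow> 'side input \<Rightarrow> 'side com \<Rightarrow> (state \<Rightarrow> event list \<Rightarrow> nat \<Rightarrow> bool) \<Rightarrow>
    state \<Rightarrow> event list \<Rightarrow> nat \<Rightarrow> bool"
where
  "wp M I c Q s es t \<longleftrightarrow> (\<exists>es' t' s'. exec M I c s es' t' s' \<and> Q s' (es @ es') (t + t'))"

inductive_cases exec_DoE: "exec M I (Do i) s es t s'"
inductive_cases exec_SeqE: "exec M I (Seq c d) s es t s'"
inductive_cases exec_CondE: "exec M I (Cond b c d) s es t s'"

lemma exec_While_iff:
  "exec M I (While b c) s es t s' \<longleftrightarrow>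
    (if test_value b s
     then \<exists>es1 t1 s1 es2 t2. es = es1 @ es2 \<and> t = 1 + t1 + t2 \<and> exec M I c s es1 t1 s1 \<and>
       exec M I (While b c) s1 es2 t2 s'
     else es = [] \<and> t = 1 \<and> s' = s)"
  by (subst exec.simps) auto

lemma wp_Do:
  "wp M I (Do i) Q s es t \<longleftrightarrow>
    (\<exists>s'. instr_result M I i s = Some s' \<and> Q s' (es @ instr_events i s) (t + 1))"
  unfolding wp_def by (metis exec_Do exec_DoE)

lemma wp_Seq: "wp M I (Seq c d) Q s es t \<longleftrightarrow> wp M I c (wp M I d Q) s es t"
proof
  assume "wp M I (Seq c d) Q s es t"
  then show "wp M I c (wp M I d Q) s es t"
    unfolding wp_def by (fastforce elim!: exec_SeqE simp: add.assoc)
next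
  assume "wp M I c (wp M I d Q) s es t"
  then show "wp M I (Seq c d) Q s es t"
    unfolding wp_def by (metis exec_Seq append.assoc add.assoc)
qed

lemma wp_Cond:
  "wp M I (Cond b c d) Q s es t \<longleftrightarrow>
    (if test_value b s then wp M I c Q s es (t + 1) else wp M I d Q s es (t + 1))"
proof
  assume "wp M I (Cond b c d) Q s es t"
  then show "if test_value b s then wp M I c Q s es (t + 1) else wp M I d Q s es (t + 1)"
    unfolding wp_def by (fastforce elim!: exec_CondE simp: add.assoc)
next
  assume "if test_value b s then wp M I c Q s es (t + 1) else wp M I d Q s es (t + 1)"
  then show "wp M I (Cond b c d) Q s es t"
    unfolding wp_def by (metis exec_Cond_True exec_Cond_False add.assoc)
qed

lemma wp_While:
  "wp M I (While b c) Q s es t \<longleftrightarrow>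
    (if test_value b s then wp M I c (wp M I (While b c) Q) s es (t + 1) else Q s es (t + 1))"
proof
  assume "wp M I (While b c) Q s es t"
  then obtain es' t' s' where e: "exec M I (While b c) s es' t' s'" "Q s' (es @ es') (t + t')"
    unfolding wp_def by blast
  show "if test_value b s then wp M I c (wp M I (While b c) Q) s es (t + 1) else Q s es (t + 1)"
  proof (cases "test_value b s")
    case False
    then show ?thesis using e by (simp add: exec_While_iff)
  next
    case True
    then obtain es1 t1 s1 es2 t2 where *: "es' = es1 @ es2" "t' = 1 + t1 + t2"
      "exec M I c s es1 t1 s1" "exec M I (While b c) s1 es2 t2 s'"
      using e(1) exec_While_iff[of M I b c s es' t' s'] by auto
    then have "wp M I (While b c) Q s1 (es @ es1) (t + 1 + t1)"
      unfolding wp_def using e(2)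
      by (intro exI[of _ es2] exI[of _ t2] exI[of _ s']) (simp add: add.assoc)
    with *(3) have "wp M I c (wp M I (While b c) Q) s es (t + 1)"
      unfolding wp_def[of M I c] by blast
    with True show ?thesis by simp
  qed
next
  assume *: "if test_value b s then wp M I c (wp M I (While b c) Q) s es (t + 1) else Q s es (t + 1)"
  show "wp M I (While b c) Q s es t"
  proof (cases "test_value b s")
    case True
    with * obtain es1 t1 s1 es2 t2 s2 where
      "exec M I c s es1 t1 s1" "exec M I (While b c) s1 es2 t2 s2"
      "Q s2 ((es @ es1) @ es2) (t + 1 + t1 + t2)"
      unfolding wp_def by auto
    then show ?thesis unfolding wp_def using exec_While_True[OF True, of M I c es1 t1 s1 es2 t2 s2]
      by (intro exI[of _ "es1 @ es2"] exI[of _ "1 + t1 + t2"] exI[of _ s2]) (simp add: add.assoc)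
  next
    case False
    with * show ?thesis unfolding wp_def using exec_While_False[OF False, of M I c]
      by (intro exI[of _ "[]"] exI[of _ 1] exI[of _ s]) simp
  qed
qed

lemma wp_While_stop: "\<not> test_value b s \<Longrightarrow> wp M I (While b c) Q s es t \<longleftrightarrow> Q s es (Suc t)"
  by (subst wp_While) simp

lemma wp_mono:
  assumes "wp M I c Q s es t" "\<And>s' es' t'. Q s' es' t' \<Longrightarrow> R s' es' t'"
  shows "wp M I c R s es t"
  using assms unfolding wp_def by blast

text \<open>The bound on the running time contained in the invariant doubles as a termination measure.\<close>

lemma wp_While_bounded:
  assumes bound: "\<And>s es t. J s es t \<Longrightarrow> t \<le> T"
    and body: "\<And>s es t. J s es t \<Longrightarrow> test_value b s \<Longrightarrow> wp M I c J s es (t + 1)"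
    and "J s es t"
  shows "wp M I (While b c) (\<lambda>s es t. \<not> test_value b s \<and> (\<exists>t'. t = t' + 1 \<and> J s es t')) s es t"
    (is "wp M I _ ?Q s es t")
  using \<open>J s es t\<close>
proof (induction "T - t" arbitrary: s es t rule: less_induct)
  case less
  show ?case
  proof (cases "test_value b s")
    case True
    then obtain es' t' s' where e: "exec M I c s es' t' s'" "J s' (es @ es') (t + 1 + t')"
      using body[OF less.prems] unfolding wp_def by blast
    with bound have "t + 1 + t' \<le> T" by blast
    then have "wp M I (While b c) ?Q s' (es @ es') (t + 1 + t')"
      by (intro less.hyps e(2)) simp
    with e(1) have "wp M I c (wp M I (While b c) ?Q) s es (t + 1)"
      unfolding wp_def[of M I c] by blast
    with True show ?thesis by (subst wp_While) simp
  next
    case False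
    with less.prems show ?thesis by (subst wp_While) simp
  qed
qed

section \<open>The program\<close>

fun seq :: "'side com list \<Rightarrow> 'side com" where
  "seq [] = Do (Move 0 0)"
| "seq [c] = c"
| "seq (c # d # cs) = Seq c (seq (d # cs))"

abbreviation (input) "rZero \<equiv> 0 :: nat"
abbreviation (input) "rOne \<equiv> 1 :: nat"
abbreviation (input) "rTwo \<equiv> 2 :: nat"
abbreviation (input) "rFour \<equiv> 3 :: nat"
abbreviation (input) "rSize \<equiv> 4 :: nat"
abbreviation (input) "rRoot \<equiv> 5 :: nat"
abbreviation (input) "rCur \<equiv> 6 :: nat"
abbreviation (input) "rPos \<equiv> 7 :: nat"
abbreviation (input) "rTop \<equiv> 8 :: nat"
abbreviation (input) "rMode \<equiv> 9 :: nat"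
abbreviation (input) "rOutdeg \<equiv> 10 :: nat"
abbreviation (input) "rOff \<equiv> 11 :: nat"
abbreviation (input) "rDeg \<equiv> 12 :: nat"
abbreviation (input) "rK \<equiv> 13 :: nat"
abbreviation (input) "rAddr \<equiv> 14 :: nat"
abbreviation (input) "rX \<equiv> 15 :: nat"
abbreviation (input) "rFlag \<equiv> 16 :: nat"
abbreviation (input) "rNext \<equiv> 17 :: nat"

definition skip :: "'side com" where
  "skip = Do (Move rZero rZero)"

definition get_offset :: "'side \<Rightarrow> bool \<Rightarrow> 'side com" where
  "get_offset so dir = Do (if dir then Access (Deg so) rOff rCur rZero else Const rOff 0)"

text \<open>Repeated in every iteration of the walk, since nothing but a counter is kept for a gray
  vertex below the current one. The final \<open>Cond\<close> adds the fictitious last position of a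
  root.\<close>

definition get_degrees :: "'side \<Rightarrow> 'side \<Rightarrow> bool \<Rightarrow> 'side com" where
  "get_degrees so si dir = seq [
     Do (Access (Deg so) rOutdeg rCur rZero),
     get_offset so dir,
     Do (Access (Deg si) rX rCur rZero),
     Do (Op Add rDeg rOff rX),
     Cond (Eq rCur rRoot) (Do (Op Add rDeg rDeg rOne)) skip]"

definition advance :: "'side com" where
  "advance = seq [
     Do (Op Add rPos rPos rOne),
     Cond (Eq rPos rDeg) (Do (Const rPos 0)) skip]"

definition grow_loop :: "'side com" where
  "grow_loop = While (Less rZero rK) (seq [
     Do (Op Add rTop rTop rOne),
     Do (Op Shr rK rK rOne)])"

definition write_loop :: "'side com" where
  "write_loop = While (Less rZero rK) (seq [
     Do (Op Sub rAddr rAddr rOne),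
     Do (Op And rX rK rOne),
     Do (Store rAddr rX),
     Do (Op Shr rK rK rOne)])"

text \<open>Propagation of a borrow: a 0 becomes 1 and the borrow moves on; a 1 becomes 0, sets
  \<open>rFlag\<close> and ends the loop by clearing \<open>rK\<close>. If \<open>rFlag\<close>
  stays unset, the counter was 0 and \<open>rAddr\<close> has reached its lower end.\<close>

definition decrement_loop :: "'side com" where
  "decrement_loop = While (Less rZero rK) (seq [
     Do (Op Sub rAddr rAddr rOne),
     Do (Load rX rAddr),
     Cond (Eq rX rZero)
       (seq [
          Do (Store rAddr rOne),
          Do (Op Shr rK rK rOne)])
       (seq [
          Do (Store rAddr rZero),
          Do (Const rFlag 1),
          Do (Const rK 0)])])"

text \<open>A single position must be that of the parent, so the vertex can finish at once.
  Otherwise the walk starts one position after the parent's, with \<open>rDeg - 2\<close> positions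
  left in between. \<open>rK\<close> is loaded twice because \<open>grow_loop\<close> consumes
  it.\<close>

definition start_vertex :: "'side com" where
  "start_vertex = Cond (Less rOne rDeg)
     (seq [
        Do (Op Sub rK rDeg rTwo),
        grow_loop,
        Do (Op Sub rK rDeg rTwo),
        Do (Move rAddr rTop),
        write_loop,
        advance,
        Do (Const rMode 1)])
     (Do (Const rMode 3))"

text \<open>Positions from \<open>rOutdeg\<close> on carry no out-edge. On a discovery,
  \<open>Mate\<close> yields the position of the current vertex in the array of the child, so that
  \<open>rPos\<close> enters the child as its parent position.\<close>

definition explore_edge :: "'side \<Rightarrow> bool \<Rightarrow> 'side com" where
  "explore_edge so dir = Cond (Less rPos rOutdeg)
     (seq [
        Do (Access (Head so) rNext rCur rPos),
        Do (Op Sub rAddr rNext rOne),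
        Do (Load rX rAddr),
        Cond (Eq rX rZero)
          (seq [
             Do (Store rAddr rOne),
             Do (Invoke_Edge Explore_New rCur rPos),
             Do (Invoke_Vertex Discover rNext),
             Do (Access (Mate so) rPos rCur rPos),
             Do (Move rCur rNext),
             get_offset so dir,
             Do (Op Add rPos rPos rOff),
             Do (Const rMode 0)])
          (seq [
             Do (Invoke_Edge Explore_Old rCur rPos),
             Do (Const rMode 2)])])
     (Do (Const rMode 2))"

text \<open>When the counter was 0, \<open>rAddr\<close> is its lower end, and moving it to
  \<open>rTop\<close> pops the counter.\<close>

definition next_position :: "'side com" where
  "next_position = seq [
     Do (Op Sub rK rDeg rTwo),
     Do (Move rAddr rTop),
     Do (Const rFlag 0),
     decrement_loop,
     advance,
     Cond (Eq rFlag rZero)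
       (seq [
          Do (Move rTop rAddr),
          Do (Const rMode 3)])
       (Do (Const rMode 1))]"

text \<open>In an undirected graph the edge to the parent must still be explored from this endpoint;
  in a directed graph, and at a root, the parent position lies beyond \<open>rOutdeg\<close>. The
  second \<open>Mate\<close> query restores the position of the parent, which was not stored on the
  stack.\<close>

definition finish_vertex :: "'side \<Rightarrow> 'side com" where
  "finish_vertex si = seq [
     Cond (Less rPos rOutdeg) (Do (Invoke_Edge Explore_Old rCur rPos)) skip,
     Do (Invoke_Vertex Finish rCur),
     Cond (Eq rCur rRoot)
       (Do (Const rMode 4))
       (seq [
          Do (Op Sub rX rPos rOff),
          Do (Access (Head si) rNext rCur rX),
          Do (Access (Mate si) rPos rCur rX),
          Do (Move rCur rNext),
          Do (Invoke_Edge Withdraw rCur rPos),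
          Do (Const rMode 2)])]"

text \<open>
  Modes: 0 = just discovered, no counter yet; 1 = explore the current position; 2 = go to the next
  position; 3 = at the position of the parent, counter removed; 4 = root finished.
\<close>

definition walk_body :: "'side \<Rightarrow> 'side \<Rightarrow> bool \<Rightarrow> 'side com" where
  "walk_body so si dir = seq [
     get_degrees so si dir,
     Cond (Eq rMode rZero) start_vertex
       (Cond (Eq rMode rOne) (explore_edge so dir)
         (Cond (Eq rMode rTwo) next_position (finish_vertex si)))]"

text \<open>The mark of vertex v is at address v - 1, hence the copy of \<open>rRoot\<close> to
  \<open>rAddr\<close> before the increment. \<open>rPos\<close> starts at the degree, the
  fictitious parent position of a root.\<close>

definition root_body :: "'side \<Rightarrow> 'side \<Rightarrow> bool \<Rightarrow> 'side com" where
  "root_body so si dir = seq [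
     Do (Move rAddr rRoot),
     Do (Op Add rRoot rRoot rOne),
     Do (Load rX rAddr),
     Cond (Eq rX rZero)
       (seq [
          Do (Store rAddr rOne),
          Do (Invoke_Vertex Discover rRoot),
          Do (Move rCur rRoot),
          get_offset so dir,
          Do (Access (Deg si) rX rCur rZero),
          Do (Op Add rPos rOff rX),
          Do (Const rMode 0),
          While (Less rMode rFour) (walk_body so si dir)])
       skip]"

definition dfs_program :: "'side \<Rightarrow> 'side \<Rightarrow> bool \<Rightarrow> 'side com" where
  "dfs_program so si dir = seq [
     Do (Const rOne 1),
     Do (Const rTwo 2),
     Do (Const rFour 4),
     Do (Get_Size rSize),
     Do (Move rTop rSize),
     While (Less rRoot rSize) (root_body so si dir)]"

text \<open>At most 18 registers, charged to the O(log n) term.\<close>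

lemma registers_dfs_program: "registers (dfs_program so si dir) \<subseteq> {..17}"
  by (cases dir) (simp_all add: dfs_program_def root_body_def walk_body_def finish_vertex_def
    next_position_def explore_edge_def start_vertex_def decrement_loop_def write_loop_def
    grow_loop_def advance_def get_degrees_def get_offset_def skip_def)

section \<open>Bit lengths, \<open>bitlength k\<close> being
  \<open>\<lceil>log (k + 1)\<rceil>\<close>, and the cost of counting down\<close>

fun bitlength :: "nat \<Rightarrow> nat" where
  "bitlength k = (if k = 0 then 0 else Suc (bitlength (k div 2)))"

declare bitlength.simps [simp del]

lemma bitlength_0 [simp]: "bitlength 0 = 0"
  by (simp add: bitlength.simps)

lemma bitlength_pos: "0 < k \<Longrightarrow> bitlength k = Suc (bitlength (k div 2))"
  by (subst bitlength.simps) simp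

lemma bitlength_le: "bitlength k \<le> k"
  by (induction k rule: bitlength.induct) (subst bitlength.simps, auto)

lemma bitlength_mono: "k \<le> l \<Longrightarrow> bitlength k \<le> bitlength l"
proof (induction k arbitrary: l rule: bitlength.induct)
  case (1 k)
  then show ?case
    using bitlength_pos[of k] bitlength_pos[of l] by (cases "k = 0") (auto simp: div_le_mono)
qed

text \<open>Bounds the effect of the additional position of a root by one bit.\<close>

lemma bitlength_Suc_le: "bitlength (Suc k) \<le> Suc (bitlength k)"
proof (induction k rule: bitlength.induct)
  case (1 k)
  show ?case
  proof (cases "k = 0")
    case True
    then show ?thesis by (simp add: bitlength_pos)
  next
    case False
    have "bitlength (Suc k div 2) \<le> Suc (bitlength (k div 2))"
    proof (cases "even k")
      case True
      then have "Suc k div 2 = k div 2" by simp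
      then show ?thesis by simp
    next
      case odd: False
      then have "Suc k div 2 = Suc (k div 2)" by (simp add: odd_Suc_div_two)
      then show ?thesis using 1 False by simp
    qed
    then show ?thesis using False bitlength_pos[of k] bitlength_pos[of "Suc k"] by simp
  qed
qed

text \<open>
  The number of bits inspected while a binary counter is decremented from c down to 0:
  \<open>dec_cost c\<close> exceeds \<open>dec_cost (c - 1)\<close> by the position of the lowest 1 of c, counted from 1.
\<close>

fun dec_cost :: "nat \<Rightarrow> nat" where
  "dec_cost c = (if c = 0 then 0 else c + dec_cost (c div 2))"

declare dec_cost.simps [simp del]

lemma dec_cost_0 [simp]: "dec_cost 0 = 0"
  by (simp add: dec_cost.simps)

lemma dec_cost_pos: "0 < c \<Longrightarrow> dec_cost c = c + dec_cost (c div 2)"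
  by (subst dec_cost.simps) simp

lemma dec_cost_le: "dec_cost c \<le> 2 * c"
  by (induction c rule: dec_cost.induct) (subst dec_cost.simps, auto)

lemma dec_cost_mono: "b \<le> c \<Longrightarrow> dec_cost b \<le> dec_cost c"
proof (induction b arbitrary: c rule: dec_cost.induct)
  case (1 b)
  then show ?case
    using dec_cost_pos[of b] dec_cost_pos[of c] by (cases "b = 0") (auto intro!: add_mono div_le_mono)
qed

lemma dec_cost_odd: "odd c \<Longrightarrow> dec_cost c = Suc (dec_cost (c - 1))"
proof -
  assume "odd c"
  then obtain b where "c = Suc (2 * b)" by (auto elim: oddE)
  then show ?thesis using dec_cost_pos[of c] dec_cost_pos[of "2 * b"] by (cases "b = 0") auto
qed

text \<open>The lowest 1 of an even \<open>c\<close> lies one place higher than that of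
  \<open>c div 2\<close>, so its decrement inspects one bit more. The additive form avoids
  subtraction on naturals; it matches one step of the borrow.\<close>

lemma dec_cost_even:
  assumes "even c" "0 < c"
  shows "dec_cost c + dec_cost (c div 2 - 1) = Suc (dec_cost (c - 1) + dec_cost (c div 2))"
proof -
  obtain b where c: "c = 2 * b" using assms by auto
  with assms have "b > 0" by simp
  then have "(2 * b - 1) div 2 = b - 1" by presburger
  with \<open>b > 0\<close> show ?thesis
    using dec_cost_pos[of c] dec_cost_pos[of "2 * b - 1"] c by simp
qed

text \<open>The counter c below address a, least significant bit first (it is on top of the stack).\<close>

definition counter_at :: "(nat \<Rightarrow> nat) \<Rightarrow> nat \<Rightarrow> nat \<Rightarrow> nat \<Rightarrow> bool" where
  "counter_at f a k c \<longleftrightarrow> (\<forall>j < bitlength k. f (a - 1 - j) = c div 2 ^ j mod 2)"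

text \<open>Memory words are cut down to single bits, so that nothing is lost by packing counters of
  different widths. The strict inequality for \<open>mem_words\<close> lets a register also hold the
  address just above a full stack.\<close>

locale bit_machine =
  fixes M :: machine and I :: "'side input"
  assumes mem_bits: "mem_bits M = 1"
    and reg_bits_le: "reg_bits M \<le> word_length M"
    and mem_words_le: "mem_words M < 2 ^ reg_bits M"
begin

lemma set_reg_Some [simp]:
  assumes "x < 2 ^ reg_bits M"
  shows "set_reg M r x s = Some (s\<lparr>reg := (reg s)(r := x)\<rparr>)"
proof -
  have "x < 2 ^ word_length M"
    using assms reg_bits_le by (meson less_le_trans one_le_numeral power_increasing)
  then show ?thesis using assms by (simp add: set_reg_def Let_def take_bit_nat_eq_self)
qed

lemma set_reg_take_bit [simp]: "set_reg M r (take_bit (word_length M) x) s = set_reg M r x s"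
  by (simp add: set_reg_def)

lemma set_reg_Sub [simp]:
  assumes "y \<le> x" "x < 2 ^ reg_bits M"
  shows "set_reg M r (x + 2 ^ word_length M - y) s = Some (s\<lparr>reg := (reg s)(r := x - y)\<rparr>)"
proof -
  have "x + 2 ^ word_length M - y = (x - y) + 2 ^ word_length M" using assms by simp
  then have "set_reg M r (x + 2 ^ word_length M - y) s = set_reg M r (x - y) s"
    by (simp add: set_reg_def take_bit_eq_mod)
  then show ?thesis using assms by simp
qed

lemma words_less: "a \<le> mem_words M \<Longrightarrow> a < 2 ^ reg_bits M"
  using mem_words_le by simp

section \<open>Loops on binary counters\<close>

lemma grow_loop:
  assumes "reg s rZero = 0" "reg s rOne = 1" "reg s rK < 2 ^ reg_bits M"
    and "reg s rTop + bitlength (reg s rK) \<le> mem_words M"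
  shows "wp M I grow_loop (\<lambda>s' es' t'. es' = es \<and> mem s' = mem s \<and>
     reg s' = (reg s)(rK := 0, rTop := reg s rTop + bitlength (reg s rK)) \<and>
     t' = t + 1 + 3 * bitlength (reg s rK)) s es t"
  using assms
proof (induction "reg s rK" arbitrary: s t rule: less_induct)
  case less
  show ?case
  proof (cases "reg s rK = 0")
    case True
    then have "(reg s)(rK := 0, rTop := reg s rTop) = reg s" by auto
    with True less.prems show ?thesis
      unfolding grow_loop_def by (subst wp_While) simp
  next
    case False
    let ?s = "s\<lparr>reg := (reg s)(rTop := Suc (reg s rTop), rK := reg s rK div 2)\<rparr>"
    have bl: "bitlength (reg s rK) = Suc (bitlength (reg s rK div 2))"
      using False by (simp add: bitlength_pos)
    have [simp]: "Suc (reg s rTop) < 2 ^ reg_bits M"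
      using less.prems bl by (intro words_less) simp
    have [simp]: "reg s rK div 2 < 2 ^ reg_bits M"
      using less.prems by (meson div_le_dividend le_less_trans)
    have "wp M I grow_loop (\<lambda>s' es' t'. es' = es \<and> mem s' = mem ?s \<and>
       reg s' = (reg ?s)(rK := 0, rTop := reg ?s rTop + bitlength (reg ?s rK)) \<and>
       t' = Suc (Suc (Suc t)) + 1 + 3 * bitlength (reg ?s rK)) ?s es (Suc (Suc (Suc t)))"
      using False less.prems bl by (intro less.hyps) simp_all
    then have "wp M I grow_loop (\<lambda>s' es' t'. es' = es \<and> mem s' = mem s \<and>
       reg s' = (reg s)(rK := 0, rTop := reg s rTop + bitlength (reg s rK)) \<and>
       t' = t + 1 + 3 * bitlength (reg s rK)) ?s es (Suc (Suc (Suc t)))"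
      by (rule wp_mono) (auto simp: bl)
    with False less.prems show ?thesis
      unfolding grow_loop_def
      by (subst wp_While) (simp add: wp_Seq wp_Do drop_bit_eq_div)
  qed
qed

text \<open>Peels off the lowest bit, the one on top of the stack; this is the inductive step of
  both the writing and the decrementing loop.\<close>

lemma counter_at_pos:
  assumes "0 < k"
  shows "counter_at f a k c \<longleftrightarrow> f (a - 1) = c mod 2 \<and> counter_at f (a - 1) (k div 2) (c div 2)"
proof -
  have "counter_at f a k c \<longleftrightarrow>
      (\<forall>j < Suc (bitlength (k div 2)). f (a - 1 - j) = c div 2 ^ j mod 2)"
    using assms by (simp add: counter_at_def bitlength_pos)
  also have "\<dots> \<longleftrightarrow> f (a - 1) = c mod 2 \<and>
      (\<forall>j < bitlength (k div 2). f (a - 1 - Suc j) = c div 2 ^ Suc j mod 2)"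
    unfolding All_less_Suc2 by simp
  also have "\<dots> \<longleftrightarrow> f (a - 1) = c mod 2 \<and> counter_at f (a - 1) (k div 2) (c div 2)"
    by (simp add: counter_at_def div_mult2_eq)
  finally show ?thesis .
qed

lemma counter_at_cong:
  assumes "\<And>j. a - bitlength k \<le> j \<Longrightarrow> j < a \<Longrightarrow> f j = g j" "bitlength k \<le> a"
  shows "counter_at f a k c \<longleftrightarrow> counter_at g a k c"
  unfolding counter_at_def using assms by (intro all_cong) (metis Suc_leI diff_Suc_less diff_diff_left
      diff_le_mono2 le_less_trans less_le_trans not_less_zero plus_1_eq_Suc zero_less_iff_neq_zero)

lemma write_loop:
  assumes "reg s rZero = 0" "reg s rOne = 1" "reg s rK < 2 ^ reg_bits M"
    and "bitlength (reg s rK) \<le> reg s rAddr" "reg s rAddr \<le> mem_words M"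
  shows "wp M I write_loop (\<lambda>s' es' t'. es' = es \<and>
     (\<exists>x. reg s' = (reg s)(rK := 0, rAddr := reg s rAddr - bitlength (reg s rK), rX := x)) \<and>
     counter_at (mem s') (reg s rAddr) (reg s rK) (reg s rK) \<and>
     (\<forall>j. j < reg s rAddr - bitlength (reg s rK) \<or> reg s rAddr \<le> j \<longrightarrow> mem s' j = mem s j) \<and>
     t' = t + 1 + 5 * bitlength (reg s rK)) s es t"
  using assms
proof (induction "reg s rK" arbitrary: s t rule: less_induct)
  case less
  show ?case
  proof (cases "reg s rK = 0")
    case True
    then have "(reg s)(rK := 0, rAddr := reg s rAddr, rX := reg s rX) = reg s" by auto
    with True less.prems show ?thesis
      unfolding write_loop_def by (subst wp_While) (simp add: counter_at_def, metis)
  next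
    case False
    let ?k = "reg s rK" and ?a = "reg s rAddr"
    let ?s = "s\<lparr>mem := (mem s)(?a - 1 := ?k mod 2),
      reg := (reg s)(rAddr := ?a - 1, rX := ?k mod 2, rK := ?k div 2)\<rparr>"
    have bl: "bitlength ?k = Suc (bitlength (?k div 2))"
      using False by (simp add: bitlength_pos)
    have pos: "0 < ?a" using less.prems bl by simp
    have [simp]: "?a < 2 ^ reg_bits M" "?a - Suc 0 < 2 ^ reg_bits M" "Suc 0 \<le> ?a"
      "?a - Suc 0 < mem_words M"
      using less.prems bl words_less[of ?a] by auto
    have [simp]: "?k mod 2 < 2 ^ reg_bits M" "?k div 2 < 2 ^ reg_bits M"
      using less.prems by (meson div_le_dividend mod_less_eq_dividend le_less_trans)+
    have "wp M I write_loop (\<lambda>s' es' t'. es' = es \<and>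
       (\<exists>x. reg s' = (reg ?s)(rK := 0, rAddr := reg ?s rAddr - bitlength (reg ?s rK), rX := x)) \<and>
       counter_at (mem s') (reg ?s rAddr) (reg ?s rK) (reg ?s rK) \<and>
       (\<forall>j. j < reg ?s rAddr - bitlength (reg ?s rK) \<or> reg ?s rAddr \<le> j \<longrightarrow> mem s' j = mem ?s j) \<and>
       t' = t + 5 + 1 + 5 * bitlength (reg ?s rK)) ?s es (t + 5)"
      using False less.prems bl by (intro less.hyps) simp_all
    then have "wp M I write_loop (\<lambda>s' es' t'. es' = es \<and>
       (\<exists>x. reg s' = (reg s)(rK := 0, rAddr := ?a - bitlength ?k, rX := x)) \<and>
       counter_at (mem s') ?a ?k ?k \<and>
       (\<forall>j. j < ?a - bitlength ?k \<or> ?a \<le> j \<longrightarrow> mem s' j = mem s j) \<and>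
       t' = t + 1 + 5 * bitlength ?k) ?s es (t + 5)"
    proof (rule wp_mono, elim conjE exE, intro conjI)
      fix s' es' t' x
      assume reg': "reg s' = (reg ?s)(rK := 0, rAddr := reg ?s rAddr - bitlength (reg ?s rK), rX := x)"
      show "\<exists>x. reg s' = (reg s)(rK := 0, rAddr := ?a - bitlength ?k, rX := x)"
        unfolding reg' by (intro exI[of _ x]) (auto simp: bl)
    next
      fix s' :: state
      assume c: "counter_at (mem s') (reg ?s rAddr) (reg ?s rK) (reg ?s rK)"
        and m: "\<forall>j. j < reg ?s rAddr - bitlength (reg ?s rK) \<or> reg ?s rAddr \<le> j \<longrightarrow> mem s' j = mem ?s j"
      show "counter_at (mem s') ?a ?k ?k" using c m False by (simp add: counter_at_pos)
      show "\<forall>j. j < ?a - bitlength ?k \<or> ?a \<le> j \<longrightarrow> mem s' j = mem s j"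
        using m pos by (auto simp: bl)
    qed (simp_all add: bl)
    moreover have "t + 5 = Suc (Suc (Suc (Suc (Suc t))))" by simp
    ultimately show ?thesis
      using False less.prems mem_bits
      unfolding write_loop_def
      by (subst wp_While) (simp add: wp_Seq wp_Do drop_bit_eq_div and_one_eq)
  qed
qed

text \<open>A successful decrement is charged to the fall of \<open>dec_cost\<close>, at 7 steps per
  inspected bit and 1 for the last test; a failing one costs the full width. The final address is
  specified only on failure and the new counter only on success, as only these are used
  afterwards.\<close>

lemma decrement_loop:
  assumes "reg s rZero = 0" "reg s rOne = 1" "reg s rK < 2 ^ reg_bits M"
    and "bitlength (reg s rK) \<le> reg s rAddr" "reg s rAddr \<le> mem_words M"
    and "counter_at (mem s) (reg s rAddr) (reg s rK) c" "c \<le> reg s rK"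
  shows "wp M I decrement_loop (\<lambda>s' es' t'. es' = es \<and>
     (\<exists>x a. reg s' = (reg s)(rK := 0, rX := x, rAddr := a, rFlag := (if c = 0 then reg s rFlag else 1)) \<and>
        (c = 0 \<longrightarrow> a = reg s rAddr - bitlength (reg s rK))) \<and>
     (c \<noteq> 0 \<longrightarrow> counter_at (mem s') (reg s rAddr) (reg s rK) (c - 1)) \<and>
     (\<forall>j. j < reg s rAddr - bitlength (reg s rK) \<or> reg s rAddr \<le> j \<longrightarrow> mem s' j = mem s j) \<and>
     (if c = 0 then t' \<le> t + 1 + 7 * bitlength (reg s rK)
      else t' + 7 * dec_cost (c - 1) \<le> t + 1 + 7 * dec_cost c)) s es t"
  using assms
proof (induction "reg s rK" arbitrary: s t c rule: less_induct)
  case less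
  show ?case
  proof (cases "reg s rK = 0")
    case True
    then have "(reg s)(rK := 0, rX := reg s rX, rAddr := reg s rAddr, rFlag := reg s rFlag) = reg s"
      by auto
    with True less.prems show ?thesis
      unfolding decrement_loop_def
      by (subst wp_While) (simp, metis)
  next
    case False
    let ?k = "reg s rK" and ?a = "reg s rAddr"
    have bl: "bitlength ?k = Suc (bitlength (?k div 2))"
      using False by (simp add: bitlength_pos)
    have pos: "0 < ?a" using less.prems bl by simp
    have [simp]: "?a < 2 ^ reg_bits M" "?a - Suc 0 < 2 ^ reg_bits M" "Suc 0 \<le> ?a"
      "?a - Suc 0 < mem_words M"
      using less.prems bl words_less[of ?a] by auto
    have one [simp]: "Suc 0 < 2 ^ reg_bits M"
      using False less.prems(3) by simp
    have [simp]: "?k div 2 < 2 ^ reg_bits M" "c mod 2 < 2 ^ reg_bits M"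
      using less.prems by (meson div_le_dividend mod_less_eq_dividend le_less_trans)+
    have c: "mem s (?a - 1) = c mod 2" "counter_at (mem s) (?a - 1) (?k div 2) (c div 2)"
      using less.prems False by (simp_all add: counter_at_pos)
    have cong: "counter_at ((mem s)(?a - 1 := b)) (?a - 1) (?k div 2) d \<longleftrightarrow>
        counter_at (mem s) (?a - 1) (?k div 2) d" for b d
      using less.prems bl by (intro counter_at_cong) auto
    show ?thesis
    \<comment> \<open>An odd \<open>c\<close> absorbs the borrow here. For an even \<open>c\<close>,
      the lowest bit becomes 1 and the induction hypothesis decrements
      \<open>c div 2\<close>.\<close>
    proof (cases "even c")
      case False
      then have "c div 2 = (c - 1) div 2" by (auto elim: oddE)
      with c cong[of 0 "c div 2"] False \<open>?k \<noteq> 0\<close>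
      have "counter_at ((mem s)(?a - 1 := 0)) ?a ?k (c - 1)"
        by (simp add: counter_at_pos mod_2_eq_odd)
      moreover from False have "c \<noteq> 0" "dec_cost c = Suc (dec_cost (c - 1))"
        by (auto simp: dec_cost_odd intro: Nat.gr0I)
      moreover have "c mod 2 = 1" using False by (simp add: mod_2_eq_odd)
      ultimately show ?thesis
        using \<open>?k \<noteq> 0\<close> less.prems mem_bits c(1)
        unfolding decrement_loop_def
        by (subst wp_While, simp add: wp_Seq wp_Do wp_Cond wp_While_stop bl)
          (intro conjI, rule exI[of _ 1], rule exI[of _ "?a - 1"], auto)
    next
      case True
      let ?s = "s\<lparr>mem := (mem s)(?a - 1 := 1),
        reg := (reg s)(rAddr := ?a - 1, rX := 0, rK := ?k div 2)\<rparr>"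
      let ?c = "c div 2"
      have "wp M I decrement_loop (\<lambda>s' es' t'. es' = es \<and>
         (\<exists>x a. reg s' = (reg ?s)(rK := 0, rX := x, rAddr := a, rFlag := (if ?c = 0 then reg ?s rFlag else 1)) \<and>
            (?c = 0 \<longrightarrow> a = reg ?s rAddr - bitlength (reg ?s rK))) \<and>
         (?c \<noteq> 0 \<longrightarrow> counter_at (mem s') (reg ?s rAddr) (reg ?s rK) (?c - 1)) \<and>
         (\<forall>j. j < reg ?s rAddr - bitlength (reg ?s rK) \<or> reg ?s rAddr \<le> j \<longrightarrow> mem s' j = mem ?s j) \<and>
         (if ?c = 0 then t' \<le> t + 6 + 1 + 7 * bitlength (reg ?s rK)
          else t' + 7 * dec_cost (?c - 1) \<le> t + 6 + 1 + 7 * dec_cost ?c)) ?s es (t + 6)"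
        using False less.prems bl c cong by (intro less.hyps) (simp_all add: div_le_mono)
      then have "wp M I decrement_loop (\<lambda>s' es' t'. es' = es \<and>
         (\<exists>x a. reg s' = (reg s)(rK := 0, rX := x, rAddr := a, rFlag := (if c = 0 then reg s rFlag else 1)) \<and>
            (c = 0 \<longrightarrow> a = ?a - bitlength ?k)) \<and>
         (c \<noteq> 0 \<longrightarrow> counter_at (mem s') ?a ?k (c - 1)) \<and>
         (\<forall>j. j < ?a - bitlength ?k \<or> ?a \<le> j \<longrightarrow> mem s' j = mem s j) \<and>
         (if c = 0 then t' \<le> t + 1 + 7 * bitlength ?k
          else t' + 7 * dec_cost (c - 1) \<le> t + 1 + 7 * dec_cost c)) ?s es (t + 6)"
      proof (rule wp_mono, elim conjE exE, intro conjI)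
        have c0: "?c = 0 \<longleftrightarrow> c = 0" using True by auto
        fix s' es' t' x a
        {
          assume reg': "reg s' = (reg ?s)(rK := 0, rX := x, rAddr := a,
              rFlag := (if ?c = 0 then reg ?s rFlag else 1))"
            and a: "?c = 0 \<longrightarrow> a = reg ?s rAddr - bitlength (reg ?s rK)"
          show "\<exists>x a. reg s' = (reg s)(rK := 0, rX := x, rAddr := a,
              rFlag := (if c = 0 then reg s rFlag else 1)) \<and> (c = 0 \<longrightarrow> a = ?a - bitlength ?k)"
            unfolding reg' using a c0 by (intro exI[of _ x] exI[of _ a]) (auto simp: bl)
        }
        assume m: "\<forall>j. j < reg ?s rAddr - bitlength (reg ?s rK) \<or> reg ?s rAddr \<le> j \<longrightarrow> mem s' j = mem ?s j"
        show "\<forall>j. j < ?a - bitlength ?k \<or> ?a \<le> j \<longrightarrow> mem s' j = mem s j"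
          using m pos by (auto simp: bl)
        {
          assume cnt: "?c \<noteq> 0 \<longrightarrow> counter_at (mem s') (reg ?s rAddr) (reg ?s rK) (?c - 1)"
          show "c \<noteq> 0 \<longrightarrow> counter_at (mem s') ?a ?k (c - 1)"
          proof
            assume "c \<noteq> 0"
            with True have "(c - 1) mod 2 = 1" "(c - 1) div 2 = ?c - 1" by (auto elim!: evenE) presburger+
            with cnt m c0 \<open>c \<noteq> 0\<close> False show "counter_at (mem s') ?a ?k (c - 1)"
              by (simp add: counter_at_pos)
          qed
        }
        assume "if ?c = 0 then t' \<le> t + 6 + 1 + 7 * bitlength (reg ?s rK)
          else t' + 7 * dec_cost (?c - 1) \<le> t + 6 + 1 + 7 * dec_cost ?c"
        then show "if c = 0 then t' \<le> t + 1 + 7 * bitlength ?k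
          else t' + 7 * dec_cost (c - 1) \<le> t + 1 + 7 * dec_cost c"
          using c0 bl dec_cost_even[OF True] by (auto split: if_splits)
      qed
      moreover have "t + 6 = Suc (Suc (Suc (Suc (Suc (Suc t)))))" by simp
      moreover have "c mod 2 = 0" using True by simp
      ultimately show ?thesis
        using False less.prems mem_bits c(1)
        unfolding decrement_loop_def
        by (subst wp_While) (simp add: wp_Seq wp_Do wp_Cond drop_bit_eq_div)
    qed
  qed
qed

end

section \<open>The path of gray vertices\<close>

lemma find_eq_Some_filter: "filter P xs = y # ys \<Longrightarrow> find P xs = Some y"
  by (induction xs) (auto split: if_splits)

lemma find_eq_Some_strengthen:
  "find P xs = Some u \<Longrightarrow> Q u \<Longrightarrow> (\<And>x. x \<in> set xs \<Longrightarrow> Q x \<Longrightarrow> P x) \<Longrightarrow> find Q xs = Some u"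
  by (induction xs) (auto split: if_splits)

text \<open>
  Positions are explored in cyclic order modulo m. After position i there are c more positions
  before the position \<open>(i + c + 1) mod m\<close> of the edge to the parent, which is the last one.
\<close>

definition rest :: "nat \<Rightarrow> nat \<Rightarrow> nat \<Rightarrow> nat set" where
  "rest m i c = (\<lambda>t. (i + t) mod m) ` {1..c + 1}"

lemma rest_0: "rest m i 0 = {(i + 1) mod m}"
  by (simp add: rest_def)

lemma rest_Suc: "rest m i (Suc c) = insert ((i + 1) mod m) (rest m ((i + 1) mod m) c)"
proof -
  have *: "{1..Suc c + 1} = insert 1 (Suc ` {1..c + 1})"
    by (auto simp: image_Suc_atLeastAtMost)
  have "(i + Suc t) mod m = ((i + 1) mod m + t) mod m" for t
    by (simp add: mod_simps)
  then show ?thesis unfolding rest_def * image_insert image_image by simp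
qed

text \<open>The \<open>c + 1 < m\<close> positions after \<open>i\<close> make less than a full
  turn.\<close>

lemma not_in_rest:
  assumes "i < m" "c + 1 < m"
  shows "i \<notin> rest m i c"
proof
  assume "i \<in> rest m i c"
  then obtain t where t: "1 \<le> t" "t \<le> c + 1" "i = (i + t) mod m"
    by (auto simp: rest_def)
  then have "(i + t) mod m = (i + 0) mod m" using assms by simp
  then have "m dvd t" using mod_eq_dvd_iff_nat[of i "i + t" m] by simp
  with t assms show False by (auto dest: dvd_imp_le)
qed

text \<open>Starting just after the parent position \<open>p\<close>, with \<open>m - 2\<close>
  further positions before \<open>p\<close> is reached again, the walk makes exactly one full turn.
  This justifies the initial value of the counter.\<close>

lemma insert_rest_complete:
  assumes "p < m" "2 \<le> m"
  shows "insert ((p + 1) mod m) (rest m ((p + 1) mod m) (m - 2)) = {..<m}"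
proof -
  have "insert ((p + 1) mod m) (rest m ((p + 1) mod m) (m - 2)) = rest m p (Suc (m - 2))"
    by (rule rest_Suc[symmetric])
  also have "\<dots> = {..<m}"
  proof
    show "rest m p (Suc (m - 2)) \<subseteq> {..<m}" using assms by (auto simp: rest_def)
    show "{..<m} \<subseteq> rest m p (Suc (m - 2))"
    proof
      fix x assume "x \<in> {..<m}"
      then have "x < m" by simp
      define t where "t = (if p < x then x - p else x + m - p)"
      have "t \<in> {1..m}" "(p + t) mod m = x"
        using \<open>x < m\<close> assms by (auto simp: t_def)
      then show "x \<in> rest m p (Suc (m - 2))" using assms by (auto simp: rest_def)
    qed
  qed
  finally show ?thesis .
qed

text \<open>Moving on by one and decrementing cancel, so the encoded parent position is an invariant
  of the walk.\<close>

lemma parent_position_step: "((i + 1) mod m + c + 1) mod m = (i + Suc c + 1) mod m" for i c m :: nat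
  using mod_add_left_eq[of "i + 1" m "c + 1"] by simp

lemma parent_position_start:
  fixes p m :: nat
  assumes "p < m" "2 \<le> m"
  shows "((p + 1) mod m + (m - 2) + 1) mod m = p"
proof -
  have "((p + 1) mod m + (m - 2) + 1) mod m = (p + Suc (m - 2) + 1) mod m"
    by (rule parent_position_step)
  also have "p + Suc (m - 2) + 1 = p + m" using assms by simp
  finally show ?thesis using assms by simp
qed

text \<open>
  The arrays of a graph in the form common to the directed and the undirected case: so and si
  index the arrays in which edges are explored and the arrays in which parents are found.
  In the directed case, the positions of a vertex are those of its out-array followed by those
  of its in-array. The root r of the current tree has one additional last position for
  its nonexistent parent.
\<close>

locale adjacency =
  fixes n :: nat and A :: "'side \<Rightarrow> nat \<Rightarrow> nat list" and so si :: 'side and dir :: bool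
  assumes size_pos: "1 \<le> n"
    and undirected: "\<not> dir \<Longrightarrow> si = so"
    and distinct_arrays: "u \<in> {1..n} \<Longrightarrow> distinct (A so u)" "u \<in> {1..n} \<Longrightarrow> distinct (A si u)"
    and arrays_subset: "u \<in> {1..n} \<Longrightarrow> set (A so u) \<subseteq> {1..n}" "u \<in> {1..n} \<Longrightarrow> set (A si u) \<subseteq> {1..n}"
    and cross: "u \<in> {1..n} \<Longrightarrow> v \<in> {1..n} \<Longrightarrow> v \<in> set (A so u) \<longleftrightarrow> u \<in> set (A si v)"
begin

abbreviation adj :: "nat \<Rightarrow> nat list" where
  "adj \<equiv> A so"

definition offset :: "nat \<Rightarrow> nat" where
  "offset u = (if dir then length (adj u) else 0)"

definition dg :: "nat \<Rightarrow> nat" where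
  "dg u = offset u + length (A si u)"

definition positions :: "nat \<Rightarrow> nat \<Rightarrow> nat" where
  "positions r u = dg u + (if u = r then 1 else 0)"

text \<open>Only positions with out-edges are constrained, so \<open>X\<close> may contain
  in-positions and the fictitious one, and may be \<open>UNIV\<close> for a fresh vertex.\<close>

definition pending :: "dfs_state \<Rightarrow> nat \<Rightarrow> nat set \<Rightarrow> bool" where
  "pending ds u X \<longleftrightarrow> (\<forall>x < length (adj u). (u, x) \<in> explored ds \<longleftrightarrow> x \<notin> X)"

text \<open>The clause on white vertices gives a fresh vertex all its edges to explore and leaves a
  root without a tree edge, hence without a withdrawal when it finishes.\<close>

definition base_inv :: "dfs_state \<Rightarrow> bool" where
  "base_inv ds \<longleftrightarrow> distinct (discovered ds) \<and> set (discovered ds) \<subseteq> {1..n} \<and>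
     black ds \<subseteq> set (discovered ds) \<and> (\<forall>v \<in> black ds. \<not> has_unexplored adj ds v) \<and>
     (\<forall>v. v \<notin> set (discovered ds) \<longrightarrow> tree_edge ds v = None \<and> pending ds v UNIV)"

text \<open>
  A frame (u, i, c) describes a gray vertex below the current one: the child above it was
  discovered over position i, and c positions remain before that of the parent of u.
\<close>

type_synonym frame = "nat \<times> nat \<times> nat"

text \<open>\<open>p\<close> is the position of the parent at \<open>u\<close>. Both directions of
  the tree edge are recorded, so that \<open>Head\<close> and \<open>Mate\<close> can recover the
  parent and the position \<open>i\<close> from \<open>p\<close> when \<open>u\<close>
  finishes.\<close>

definition link :: "nat \<Rightarrow> dfs_state \<Rightarrow> nat \<Rightarrow> nat \<Rightarrow> frame list \<Rightarrow> bool" where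
  "link r ds u p fr \<longleftrightarrow> (case fr of
       [] \<Rightarrow> u = r \<and> p = dg u \<and> tree_edge ds u = None
     | (v, i, _) # _ \<Rightarrow> u \<noteq> r \<and> offset u \<le> p \<and> p - offset u < length (A si u) \<and>
         A si u ! (p - offset u) = v \<and> i < length (adj v) \<and> adj v ! i = u \<and>
         tree_edge ds u = Some (v, i))"

text \<open>The parent position is not part of a frame but reconstructed from \<open>i\<close> and
  \<open>c\<close>, exactly the information available to the program on a return. The bound on
  \<open>c\<close> keeps \<open>i\<close> itself out of the pending positions.\<close>

fun chain :: "nat \<Rightarrow> dfs_state \<Rightarrow> frame list \<Rightarrow> bool" where
  "chain r ds [] \<longleftrightarrow> True"
| "chain r ds ((u, i, c) # fr) \<longleftrightarrow> i < positions r u \<and> c + 1 < positions r u \<and>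
     pending ds u (rest (positions r u) i c) \<and>
     link r ds u ((i + c + 1) mod positions r u) fr \<and> chain r ds fr"

text \<open>\<open>discovered\<close> is ordered by time, so the equation for \<open>filter\<close>
  makes the frames the gray vertices with the latest first, and \<open>u\<close> the vertex that the
  DFS rule selects.\<close>

definition path_inv :: "nat \<Rightarrow> dfs_state \<Rightarrow> nat \<Rightarrow> nat \<Rightarrow> nat set \<Rightarrow> frame list \<Rightarrow> bool" where
  "path_inv r ds u p X fr \<longleftrightarrow> base_inv ds \<and>
     filter (\<lambda>x. x \<notin> black ds) (discovered ds) = u # map fst fr \<and>
     pending ds u X \<and> link r ds u p fr \<and> chain r ds fr"

lemma length_adj_le: "length (adj u) \<le> dg u"
  unfolding dg_def offset_def using undirected by (cases dir) auto

lemma distinct_length_le: "distinct xs \<Longrightarrow> set xs \<subseteq> {1..n} \<Longrightarrow> length xs \<le> n"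
  using card_mono[of "{1..n}" "set xs"] by (simp add: distinct_card)

lemma length_array_le: "u \<in> {1..n} \<Longrightarrow> length (A so u) \<le> n" "u \<in> {1..n} \<Longrightarrow> length (A si u) \<le> n"
  by (intro distinct_length_le distinct_arrays arrays_subset; assumption)+

lemma dg_le: "u \<in> {1..n} \<Longrightarrow> dg u \<le> 2 * n"
  unfolding dg_def offset_def using length_array_le[of u] by auto

lemma link_less: "link r ds u p fr \<Longrightarrow> p < positions r u"
  by (auto simp: link_def positions_def dg_def split: list.splits)

lemma link_cong: "tree_edge ds' u = tree_edge ds u \<Longrightarrow> link r ds' u p fr \<longleftrightarrow> link r ds u p fr"
  by (simp add: link_def split: list.split)

lemma chain_cong:
  assumes "\<And>v. v \<in> fst ` set fr \<Longrightarrow> tree_edge ds' v = tree_edge ds v"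
    and "\<And>v x. v \<in> fst ` set fr \<Longrightarrow> (v, x) \<in> explored ds' \<longleftrightarrow> (v, x) \<in> explored ds"
  shows "chain r ds' fr \<longleftrightarrow> chain r ds fr"
  using assms
proof (induction fr)
  case (Cons f fr)
  obtain u i c where f: "f = (u, i, c)" by (cases f)
  have "chain r ds' fr \<longleftrightarrow> chain r ds fr" by (intro Cons.IH Cons.prems) auto
  moreover have "pending ds' u X \<longleftrightarrow> pending ds u X" for X
    using Cons.prems(2)[of u] f by (simp add: pending_def)
  ultimately show ?case using Cons.prems(1)[of u] f by (simp add: link_cong[of ds' u ds])
qed simp

text \<open>As the path consists of discovered vertices, a newly discovered vertex differs from
  \<open>r\<close> and gets no fictitious position.\<close>

lemma root_in_path: "link r ds u p fr \<Longrightarrow> chain r ds fr \<Longrightarrow> r \<in> insert u (fst ` set fr)"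
proof (induction fr arbitrary: u p)
  case Nil
  then show ?case by (simp add: link_def)
next
  case (Cons f fr)
  obtain v i c where f: "f = (v, i, c)" by (cases f)
  with Cons.prems(2) have "r \<in> insert v (fst ` set fr)" by (intro Cons.IH) auto
  with f show ?case by auto
qed

lemma path_inv_facts:
  assumes "path_inv r ds u p X fr"
  shows "base_inv ds" "pending ds u X" "link r ds u p fr" "chain r ds fr"
    "distinct (u # map fst fr)" "set (u # map fst fr) \<subseteq> set (discovered ds)"
    "set (u # map fst fr) \<subseteq> {1..n}" "u \<notin> black ds" "r \<in> set (u # map fst fr)"
    "find (\<lambda>x. x \<notin> black ds) (discovered ds) = Some u"
proof -
  show *: "base_inv ds" "pending ds u X" "link r ds u p fr" "chain r ds fr"
    using assms by (simp_all add: path_inv_def)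
  have f: "filter (\<lambda>x. x \<notin> black ds) (discovered ds) = u # map fst fr"
    using assms by (simp add: path_inv_def)
  show "distinct (u # map fst fr)" unfolding f[symmetric] using *(1) by (simp add: base_inv_def)
  show d: "set (u # map fst fr) \<subseteq> set (discovered ds)" unfolding f[symmetric] by auto
  show "set (u # map fst fr) \<subseteq> {1..n}" using d *(1) by (auto simp: base_inv_def)
  have "u \<in> set (filter (\<lambda>x. x \<notin> black ds) (discovered ds))" unfolding f by simp
  then show "u \<notin> black ds" by simp
  show "r \<in> set (u # map fst fr)" using root_in_path[OF *(3,4)] by simp
  show "find (\<lambda>x. x \<notin> black ds) (discovered ds) = Some u"
    using f by (rule find_eq_Some_filter)
qed

lemma path_inv_cong:
  assumes "path_inv r ds u p X fr" "\<And>x. x < length (adj u) \<Longrightarrow> x \<in> X \<longleftrightarrow> x \<in> Y"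
  shows "path_inv r ds u p Y fr"
  using assms by (auto simp: path_inv_def pending_def)

text \<open>Black vertices have no unexplored edges, so the latest vertex with an unexplored edge is
  the latest one that is not black. This reconciles the two \<open>find\<close> premises of the DFS
  rule.\<close>

lemma find_has_unexplored:
  assumes "path_inv r ds u p X fr" "i \<in> X" "i < length (adj u)"
  shows "find (has_unexplored adj ds) (discovered ds) = Some u" "(u, i) \<notin> explored ds"
proof -
  note inv = path_inv_facts[OF assms(1)]
  show e: "(u, i) \<notin> explored ds" using inv(2) assms(2,3) by (simp add: pending_def)
  show "find (has_unexplored adj ds) (discovered ds) = Some u"
    using inv(10)
  proof (rule find_eq_Some_strengthen)
    show "has_unexplored adj ds u" using e assms(3) by (auto simp: has_unexplored_def)
    show "x \<notin> black ds" if "has_unexplored adj ds x" for x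
      using that inv(1) by (auto simp: base_inv_def)
  qed
qed

section \<open>Steps of the DFS and their effect on the gray path\<close>

lemma discover_root:
  assumes "base_inv ds" "set (discovered ds) \<subseteq> black ds" "r \<in> {1..n}" "r \<notin> set (discovered ds)"
  obtains ds' where "dfs_step n adj ds [At_Vertex Discover r] ds'"
    "path_inv r ds' r (dg r) UNIV []" "discovered ds' = r # discovered ds"
proof -
  let ?ds = "ds\<lparr>discovered := r # discovered ds\<rparr>"
  have "dfs_step n adj ds [At_Vertex Discover r] ?ds"
    using assms by (intro dfs_root)
  moreover have "path_inv r ?ds r (dg r) UNIV []"
    using assms by (auto simp: path_inv_def base_inv_def pending_def link_def has_unexplored_def
        filter_empty_conv)
  ultimately show ?thesis using that by simp
qed

text \<open>The current vertex becomes the top frame. Its parent position \<open>p\<close> survives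
  only as a function of \<open>i\<close> and \<open>c\<close>, hence the hypothesis on
  \<open>p\<close>.\<close>

lemma explore_new_edge:
  assumes inv: "path_inv r ds u p X fr"
    and i: "i \<in> X" "i < length (adj u)" and v: "adj u ! i = v" "v \<notin> set (discovered ds)"
    and X: "X - {i} = rest (positions r u) i c" and c: "c + 1 < positions r u"
    and p: "p = (i + c + 1) mod positions r u"
    and j: "j < length (A si v)" "A si v ! j = u"
  obtains ds' where "dfs_step n adj ds [At_Edge Explore_New u i, At_Vertex Discover v] ds'"
    "path_inv r ds' v (offset v + j) UNIV ((u, i, c) # fr)" "discovered ds' = v # discovered ds"
proof -
  let ?ds = "ds\<lparr>discovered := v # discovered ds, explored := insert (u, i) (explored ds),
    tree_edge := (tree_edge ds)(v := Some (u, i))\<rparr>"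
  note facts = path_inv_facts[OF inv]
  have u: "u \<in> {1..n}" "u \<noteq> v" "v \<noteq> r" "v \<notin> fst ` set fr" "u \<notin> fst ` set fr"
    using facts v(2) by auto
  have v': "v \<in> {1..n}" using arrays_subset(1)[OF u(1)] i(2) v(1) by (metis nth_mem subsetD)
  have "dfs_step n adj ds [At_Edge Explore_New u i, At_Vertex Discover v] ?ds"
    using find_has_unexplored[OF inv i] facts(10) i v by (intro dfs_new)
  moreover have "path_inv r ?ds v (offset v + j) UNIV ((u, i, c) # fr)"
    unfolding path_inv_def
  proof (intro conjI)
    show "base_inv ?ds"
      using facts(1,6,8) u v' v(2) by (auto simp: base_inv_def pending_def has_unexplored_def)
    have "v \<notin> black ds" using facts(1) v(2) by (auto simp: base_inv_def)
    then show "filter (\<lambda>x. x \<notin> black ?ds) (discovered ?ds) = v # map fst ((u, i, c) # fr)"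
      using inv by (simp add: path_inv_def)
    show "pending ?ds v UNIV" using facts(1) v(2) u by (auto simp: base_inv_def pending_def)
    show "link r ?ds v (offset v + j) ((u, i, c) # fr)"
      using u i v j by (simp add: link_def)
    have "i < positions r u" using i(2) length_adj_le[of u] by (simp add: positions_def)
    moreover have "pending ?ds u (rest (positions r u) i c)"
      using facts(2) i X[symmetric] by (auto simp: pending_def)
    moreover have "link r ?ds u p fr" using facts(3) u(2) by (subst link_cong) auto
    moreover have "chain r ?ds fr" using facts(4) u by (subst chain_cong[of _ _ ds]) auto
    ultimately show "chain r ?ds ((u, i, c) # fr)" using c p by simp
  qed
  ultimately show ?thesis using that by simp
qed

lemma explore_old_edge:
  assumes inv: "path_inv r ds u p X fr"
    and i: "i \<in> X" "i < length (adj u)" and v: "adj u ! i \<in> set (discovered ds)"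
  obtains ds' where "dfs_step n adj ds [At_Edge Explore_Old u i] ds'"
    "path_inv r ds' u p (X - {i}) fr" "discovered ds' = discovered ds"
proof -
  let ?ds = "ds\<lparr>explored := insert (u, i) (explored ds)\<rparr>"
  note facts = path_inv_facts[OF inv]
  have u: "u \<notin> fst ` set fr" using facts(5) by auto
  have "dfs_step n adj ds [At_Edge Explore_Old u i] ?ds"
    using find_has_unexplored[OF inv i] facts(10) i v by (intro dfs_old)
  moreover have "path_inv r ?ds u p (X - {i}) fr"
    unfolding path_inv_def
  proof (intro conjI)
    show "base_inv ?ds"
      using facts(1,6) by (auto simp: base_inv_def pending_def has_unexplored_def)
    show "filter (\<lambda>x. x \<notin> black ?ds) (discovered ?ds) = u # map fst fr"
      using inv by (simp add: path_inv_def)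
    show "pending ?ds u (X - {i})" using facts(2) by (auto simp: pending_def)
    show "link r ?ds u p fr" using facts(3) by (subst link_cong) auto
    show "chain r ?ds fr" using facts(4) u by (subst chain_cong[of _ _ ds]) auto
  qed
  ultimately show ?thesis using that by simp
qed

text \<open>A parent position inside the out-array occurs only in an undirected graph and not at the
  root; the edge there leads back to the gray parent.\<close>

lemma parent_edge_old:
  assumes "path_inv r ds u p X fr" "p < length (adj u)"
  shows "adj u ! p \<in> set (discovered ds)"
proof -
  note facts = path_inv_facts[OF assms(1)]
  show ?thesis
  proof (cases fr)
    case Nil
    with facts(3) assms(2) length_adj_le[of u] show ?thesis by (simp add: link_def)
  next
    case (Cons f fr')
    with facts(3) assms(2) have "\<not> dir" "A si u ! p = fst f"
      by (auto simp: link_def offset_def split: if_splits prod.splits)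
    with undirected facts(6) Cons show ?thesis by auto
  qed
qed

text \<open>\<open>link\<close> identifies the tree edge of \<open>u\<close> with the top frame,
  which fixes the withdrawal event. The parent resumes with position \<open>i\<close> done and the
  positions after it pending, as mode 2 expects.\<close>

lemma finish_current:
  assumes inv: "path_inv r ds u p {} fr"
  obtains ds' where
    "dfs_step n adj ds (At_Vertex Finish u #
       (case fr of [] \<Rightarrow> [] | (v, i, _) # _ \<Rightarrow> [At_Edge Withdraw v i])) ds'"
    "discovered ds' = discovered ds" "base_inv ds'"
    "fr = [] \<Longrightarrow> set (discovered ds') \<subseteq> black ds'"
    "\<And>v i c fr'. fr = (v, i, c) # fr' \<Longrightarrow>
      path_inv r ds' v ((i + c + 1) mod positions r v) (rest (positions r v) i c) fr'"
proof -
  let ?ds = "ds\<lparr>black := insert u (black ds)\<rparr>"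
  note facts = path_inv_facts[OF inv]
  have u: "\<not> has_unexplored adj ds u" using facts(2) by (simp add: pending_def has_unexplored_def)
  have "(case tree_edge ds u of None \<Rightarrow> [] | Some (u, i) \<Rightarrow> [At_Edge Withdraw u i]) =
      (case fr of [] \<Rightarrow> [] | (v, i, _) # _ \<Rightarrow> [At_Edge Withdraw v i])"
    using facts(3) by (auto simp: link_def split: list.splits)
  then have step: "dfs_step n adj ds (At_Vertex Finish u #
       (case fr of [] \<Rightarrow> [] | (v, i, _) # _ \<Rightarrow> [At_Edge Withdraw v i])) ?ds"
    using dfs_finish[OF facts(10) u] by simp
  have "filter (\<lambda>x. x \<notin> insert u (black ds)) (discovered ds) =
      filter (\<lambda>x. x \<noteq> u) (filter (\<lambda>x. x \<notin> black ds) (discovered ds))"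
    unfolding filter_filter by (rule filter_cong) auto
  also have "\<dots> = filter (\<lambda>x. x \<noteq> u) (u # map fst fr)"
    using inv by (simp add: path_inv_def)
  also have "\<dots> = map fst fr" using facts(5) by (auto simp: filter_id_conv)
  finally have f: "filter (\<lambda>x. x \<notin> black ?ds) (discovered ?ds) = map fst fr" by simp
  have base: "base_inv ?ds"
    using facts(1,6) u by (auto simp: base_inv_def has_unexplored_def pending_def)
  have ch: "chain r ?ds fr" using facts(4) by (subst chain_cong[of _ _ ds]) auto
  show ?thesis
  proof (rule that[OF step _ base])
    show "set (discovered ?ds) \<subseteq> black ?ds" if "fr = []"
      using f that by (auto simp: filter_empty_conv)
    show "path_inv r ?ds v ((i + c + 1) mod positions r v) (rest (positions r v) i c) fr'"
      if "fr = (v, i, c) # fr'" for v i c fr'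
      using f base ch that by (simp add: path_inv_def)
  qed simp
qed

end

section \<open>Memory layout and potential\<close>

text \<open>The last summand of \<open>mem_words\<close> is the additional bit of a root. The bound
  on \<open>reg_bits\<close> leaves room for the constant 4 and for position numbers up to 2n +
  2.\<close>

locale dfs_machine = adjacency n A so si dir + bit_machine M I
  for n :: nat and A :: "'side \<Rightarrow> nat \<Rightarrow> nat list" and so si :: 'side and dir :: bool
    and M :: machine and I :: "'side input" +
  fixes opp :: "'side \<Rightarrow> 'side"
  assumes size_I: "size_of I = n"
    and access_I: "access I = array_access n opp A"
    and opp: "opp so = si" "opp si = so"
    and mem_words: "mem_words M = n + (\<Sum>v \<in> {1..n}. bitlength (dg v - 2)) + 1"
    and reg_bits: "2 * n + 4 \<le> 2 ^ reg_bits M"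
begin

abbreviation limit :: nat where
  "limit \<equiv> 2 ^ reg_bits M"

lemma access_Deg: "u \<in> {1..n} \<Longrightarrow> access I (Deg x) u i = Some (length (A x u))"
  by (simp add: access_I)

lemma access_Head: "u \<in> {1..n} \<Longrightarrow> i < length (A x u) \<Longrightarrow> access I (Head x) u i = Some (A x u ! i)"
  by (simp add: access_I)

lemma mate_eq:
  assumes "distinct xs" "j < length xs" "xs ! j = u"
  shows "(THE j. j < length xs \<and> xs ! j = u) = j"
  using assms by (intro the_equality) (auto simp: nth_eq_iff_index_eq)

lemma access_Mate_parent:
  assumes "u \<in> {1..n}" "v \<in> {1..n}" "k < length (A si u)" "A si u ! k = v" "i < length (adj v)" "adj v ! i = u"
  shows "access I (Mate si) u k = Some i"
  using assms by (simp add: access_I opp mate_eq distinct_arrays)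

lemma access_Mate_child:
  assumes "u \<in> {1..n}" "i < length (adj u)" "adj u ! i = v"
  obtains j where "j < length (A si v)" "A si v ! j = u" "access I (Mate so) u i = Some j"
proof -
  have v: "v \<in> {1..n}" using assms arrays_subset(1)[of u] by (metis nth_mem subsetD)
  have "u \<in> set (A si v)" using assms v cross[of u v] by (metis nth_mem)
  then obtain j where j: "j < length (A si v)" "A si v ! j = u" by (metis in_set_conv_nth)
  with assms v have "access I (Mate so) u i = Some j"
    by (simp add: access_I opp mate_eq distinct_arrays)
  with j show ?thesis using that by blast
qed

lemma positions_le: "u \<in> {1..n} \<Longrightarrow> positions r u \<le> 2 * n + 1"
  using dg_le[of u] by (cases "u = r") (auto simp: positions_def)

lemma positions_limit: "u \<in> {1..n} \<Longrightarrow> x \<le> Suc (positions r u) \<Longrightarrow> x < limit"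
  using positions_le[of u r] reg_bits by simp

definition width :: "nat \<Rightarrow> nat \<Rightarrow> nat" where
  "width r u = bitlength (positions r u - 2)"

text \<open>The stack grows upward from \<open>n\<close>, above the marks. Of a frame only
  \<open>c\<close> is in memory; \<open>u\<close> and \<open>i\<close> are recovered through the
  access functions.\<close>

fun stack_at :: "nat \<Rightarrow> (nat \<Rightarrow> nat) \<Rightarrow> nat \<Rightarrow> frame list \<Rightarrow> bool" where
  "stack_at r f a [] \<longleftrightarrow> a = n"
| "stack_at r f a ((u, i, c) # fr) \<longleftrightarrow> width r u \<le> a \<and>
     counter_at f a (positions r u - 2) c \<and> stack_at r f (a - width r u) fr"

lemma stack_at_size: "stack_at r f a fr \<Longrightarrow> a = n + (\<Sum>v \<leftarrow> map fst fr. width r v)"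
  by (induction r f a fr rule: stack_at.induct) auto

lemma stack_at_cong:
  "stack_at r f a fr \<Longrightarrow> (\<And>j. n \<le> j \<Longrightarrow> j < a \<Longrightarrow> f j = g j) \<Longrightarrow> stack_at r g a fr"
proof (induction r f a fr rule: stack_at.induct)
  case (2 r f a u i c fr)
  then have "n \<le> a - width r u" using stack_at_size[of r f "a - width r u" fr] by simp
  with 2 have "counter_at g a (positions r u - 2) c"
    by (subst counter_at_cong[of _ _ _ f]) (auto simp: width_def)
  with 2 show ?case by simp
qed simp

text \<open>Gray vertices are distinct, so each vertex pays for at most one counter, and only
  \<open>r\<close> can need a bit more than its degree accounts for. The current vertex is included
  because it may be about to push its counter.\<close>

lemma stack_fits:
  assumes "path_inv r ds u p X fr"
  shows "n + width r u + (\<Sum>v \<leftarrow> map fst fr. width r v) \<le> mem_words M"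
proof -
  note facts = path_inv_facts[OF assms]
  have "width r u + (\<Sum>v \<leftarrow> map fst fr. width r v) = (\<Sum>v \<leftarrow> u # map fst fr. width r v)" by simp
  also have "\<dots> = (\<Sum>v \<in> set (u # map fst fr). width r v)"
    using facts(5) by (rule sum_list_distinct_conv_sum_set)
  also have "\<dots> \<le> (\<Sum>v \<in> {1..n}. width r v)"
    using facts(7) by (intro sum_mono2) auto
  also have "\<dots> \<le> (\<Sum>v \<in> {1..n}. bitlength (dg v - 2) + (if v = r then 1 else 0))"
  proof (rule sum_mono)
    fix v
    have "bitlength (Suc (dg v) - 2) \<le> bitlength (Suc (dg v - 2))"
      by (rule bitlength_mono) simp
    also have "\<dots> \<le> Suc (bitlength (dg v - 2))" by (rule bitlength_Suc_le)
    finally show "width r v \<le> bitlength (dg v - 2) + (if v = r then 1 else 0)"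
      by (cases "v = r") (auto simp: width_def positions_def)
  qed
  also have "\<dots> \<le> (\<Sum>v \<in> {1..n}. bitlength (dg v - 2)) + 1"
    by (simp add: sum.distrib)
  finally show ?thesis by (simp add: mem_words)
qed

text \<open>
  Potentials, in units of 30 steps. What remains to be paid for a vertex with counter c: the
  decrements, two units for each of the c positions, and width units for finding the counter to be 0.
\<close>

definition advance_cost :: "nat \<Rightarrow> nat \<Rightarrow> nat \<Rightarrow> nat" where
  "advance_cost r u c = dec_cost c + 2 * c + width r u + 3"

text \<open>The second \<open>width\<close> pays for pushing the counter. The constant 2 pays for
  two iterations: modes 0 and 3 if there is a single position, modes 0 and 1 otherwise.\<close>

definition start_cost :: "nat \<Rightarrow> nat \<Rightarrow> nat" where
  "start_cost r u =
    (if positions r u \<le> 1 then 2 else advance_cost r u (positions r u - 2) + width r u + 2)"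

text \<open>Linear in the degree, and independent of \<open>r\<close>: it bounds
  \<open>start_cost\<close> whether or not the vertex will become a root.\<close>

definition white_cost :: "nat \<Rightarrow> nat" where
  "white_cost v = 6 * dg v + 10"

definition white_costs :: "dfs_state \<Rightarrow> nat" where
  "white_costs ds = (\<Sum>v \<in> {1..n} - set (discovered ds). white_cost v)"

definition path_costs :: "nat \<Rightarrow> frame list \<Rightarrow> nat" where
  "path_costs r fr = (\<Sum>(u, i, c) \<leftarrow> fr. advance_cost r u c)"

lemma path_costs_Cons [simp]: "path_costs r ((u, i, c) # fr) = advance_cost r u c + path_costs r fr"
  by (simp add: path_costs_def)

lemma path_costs_Nil [simp]: "path_costs r [] = 0"
  by (simp add: path_costs_def)

lemma start_cost_le: "start_cost r v \<le> white_cost v"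
proof -
  have "width r v \<le> positions r v - 2" unfolding width_def by (rule bitlength_le)
  moreover have "dec_cost (positions r v - 2) \<le> 2 * (positions r v - 2)" by (rule dec_cost_le)
  moreover have "positions r v \<le> Suc (dg v)" by (simp add: positions_def)
  ultimately show ?thesis by (auto simp: start_cost_def advance_cost_def white_cost_def)
qed

lemma white_costs_discover:
  assumes "v \<in> {1..n}" "v \<notin> set (discovered ds)" "discovered ds' = v # discovered ds"
  shows "white_costs ds = white_cost v + white_costs ds'"
proof -
  have "{1..n} - set (discovered ds') = ({1..n} - set (discovered ds)) - {v}"
    using assms(3) by auto
  then show ?thesis unfolding white_costs_def using assms(1,2)
    by (simp add: sum.remove[of _ v])
qed

section \<open>Machine states that represent a state of the DFS\<close>

definition regs :: "state \<Rightarrow> nat \<Rightarrow> bool" where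
  "regs s r \<longleftrightarrow> reg s rZero = 0 \<and> reg s rOne = 1 \<and> reg s rTwo = 2 \<and> reg s rFour = 4 \<and>
     reg s rSize = n \<and> reg s rRoot = r"

definition marks :: "(nat \<Rightarrow> nat) \<Rightarrow> dfs_state \<Rightarrow> bool" where
  "marks f ds \<longleftrightarrow> (\<forall>v \<in> {1..n}. f (v - 1) = (if v \<in> set (discovered ds) then 1 else 0))"

lemma marks_cong: "marks f ds \<Longrightarrow> (\<And>j. j < n \<Longrightarrow> f j = g j) \<Longrightarrow> marks g ds"
  unfolding marks_def by (intro ballI) (metis Suc_diff_1 Suc_le_eq One_nat_def atLeastAtMost_iff)

lemma marks_discover:
  assumes "marks f ds" "v \<in> {1..n}" "discovered ds' = v # discovered ds"
  shows "marks (f(v - 1 := 1)) ds'"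
  unfolding marks_def
proof
  fix x assume x: "x \<in> {1..n}"
  then have "x - 1 = v - 1 \<longleftrightarrow> x = v" using assms(2) by auto
  with x assms(1,3) show "(f(v - 1 := 1)) (x - 1) = (if x \<in> set (discovered ds') then 1 else 0)"
    by (auto simp: marks_def)
qed

lemma wp_skip: "reg s rZero = 0 \<Longrightarrow> wp M I skip Q s es t \<longleftrightarrow> Q s es (Suc t)"
  using fun_upd_triv[of "reg s" rZero] by (simp add: skip_def wp_Do)

lemma wp_get_offset:
  assumes "reg s rZero = 0" "reg s rCur \<in> {1..n}"
  shows "wp M I (get_offset so dir) Q s es t \<longleftrightarrow>
    Q (s\<lparr>reg := (reg s)(rOff := offset (reg s rCur))\<rparr>) es (Suc t)"
proof -
  have "length (adj (reg s rCur)) < limit"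
    using length_array_le(1)[OF assms(2)] reg_bits by simp
  then show ?thesis
    using assms unfolding get_offset_def offset_def
    by (auto simp: wp_Do access_Deg)
qed

lemma wp_get_degrees:
  assumes "regs s r" "reg s rCur = u" "u \<in> {1..n}"
  shows "wp M I (get_degrees so si dir) Q s es t \<longleftrightarrow>
    Q (s\<lparr>reg := (reg s)(rOutdeg := length (adj u), rOff := offset u, rX := length (A si u),
      rDeg := positions r u)\<rparr>) es (t + 6)"
proof -
  have [simp]: "length (adj u) < limit" "length (A si u) < limit"
      "offset u + length (A si u) < limit" "Suc (offset u + length (A si u)) < limit"
    using length_array_le[OF assms(3)] reg_bits dg_le[OF assms(3)] by (auto simp: dg_def)
  have *: "t + 6 = Suc (Suc (Suc (Suc (Suc (Suc t)))))" by simp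
  show ?thesis
    using assms unfolding get_degrees_def *
    by (cases "r = u")
      (simp_all add: regs_def wp_Seq wp_Do wp_Cond wp_skip wp_get_offset access_Deg positions_def dg_def)
qed

lemma wp_advance:
  assumes "reg s rZero = 0" "reg s rOne = 1" "reg s rDeg = m" "reg s rPos = i" "i < m" "Suc m < limit"
  shows "wp M I advance Q s es t \<longleftrightarrow> Q (s\<lparr>reg := (reg s)(rPos := (i + 1) mod m)\<rparr>) es (t + 3)"
proof -
  have *: "t + 3 = Suc (Suc (Suc t))" by simp
  show ?thesis
    using assms unfolding advance_def *
    by (cases "Suc i = m") (simp_all add: wp_Seq wp_Do wp_Cond wp_skip)
qed

text \<open>\<open>D\<close> carries a fact of the root loop through the walk: all roots tried so
  far remain discovered.\<close>

definition invariant :: "nat \<Rightarrow> nat set \<Rightarrow> state \<Rightarrow> event list \<Rightarrow> dfs_state \<Rightarrow> bool" where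
  "invariant r D s es ds \<longleftrightarrow> dfs_run n adj dfs_start es ds \<and> regs s r \<and> marks (mem s) ds \<and>
     D \<subseteq> set (discovered ds)"

text \<open>One case for each mode; \<open>T\<close> is the deadline. Modes 1 and 3 hold a unit for
  their own iteration, modes 0 and 2 draw on \<open>start_cost\<close> and
  \<open>advance_cost\<close>. The current position is still pending in mode 1, already dealt with
  in mode 2, and that of the parent in mode 3.\<close>

inductive walk_inv :: "nat \<Rightarrow> nat set \<Rightarrow> nat \<Rightarrow> state \<Rightarrow> event list \<Rightarrow> nat \<Rightarrow> bool"
  for r :: nat and D :: "nat set" and T :: nat
where
  at_start: "invariant r D s es ds \<Longrightarrow> reg s rMode = 0 \<Longrightarrow>
    path_inv r ds (reg s rCur) (reg s rPos) UNIV fr \<Longrightarrow>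
    stack_at r (mem s) (reg s rTop) fr \<Longrightarrow>
    t + 30 * (start_cost r (reg s rCur) + path_costs r fr + white_costs ds) \<le> T \<Longrightarrow>
    walk_inv r D T s es t"
| at_explore: "invariant r D s es ds \<Longrightarrow> reg s rMode = 1 \<Longrightarrow> u = reg s rCur \<Longrightarrow> i = reg s rPos \<Longrightarrow>
    path_inv r ds u ((i + c + 1) mod positions r u) (insert i (rest (positions r u) i c)) fr \<Longrightarrow>
    i < positions r u \<Longrightarrow> c + 1 < positions r u \<Longrightarrow>
    stack_at r (mem s) (reg s rTop) ((u, i, c) # fr) \<Longrightarrow>
    t + 30 * (1 + path_costs r ((u, i, c) # fr) + white_costs ds) \<le> T \<Longrightarrow>
    walk_inv r D T s es t"
| at_advance: "invariant r D s es ds \<Longrightarrow> reg s rMode = 2 \<Longrightarrow> u = reg s rCur \<Longrightarrow> i = reg s rPos \<Longrightarrow>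
    path_inv r ds u ((i + c + 1) mod positions r u) (rest (positions r u) i c) fr \<Longrightarrow>
    i < positions r u \<Longrightarrow> c + 1 < positions r u \<Longrightarrow>
    stack_at r (mem s) (reg s rTop) ((u, i, c) # fr) \<Longrightarrow>
    t + 30 * (path_costs r ((u, i, c) # fr) + white_costs ds) \<le> T \<Longrightarrow>
    walk_inv r D T s es t"
| at_finish: "invariant r D s es ds \<Longrightarrow> reg s rMode = 3 \<Longrightarrow>
    path_inv r ds (reg s rCur) (reg s rPos) {reg s rPos} fr \<Longrightarrow>
    stack_at r (mem s) (reg s rTop) fr \<Longrightarrow>
    t + 30 * (1 + path_costs r fr + white_costs ds) \<le> T \<Longrightarrow>
    walk_inv r D T s es t"
| at_end: "invariant r D s es ds \<Longrightarrow> reg s rMode = 4 \<Longrightarrow>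
    base_inv ds \<Longrightarrow> set (discovered ds) \<subseteq> black ds \<Longrightarrow> reg s rTop = n \<Longrightarrow>
    t + 30 * white_costs ds \<le> T \<Longrightarrow>
    walk_inv r D T s es t"

lemma invariant_step:
  assumes "invariant r D s es ds" "dfs_step n adj ds es' ds'" "regs s' r" "marks (mem s') ds'"
    "set (discovered ds) \<subseteq> set (discovered ds')"
  shows "invariant r D s' (es @ es') ds'"
  using assms dfs_run_snoc unfolding invariant_def by blast

section \<open>One iteration of the walk, mode by mode\<close>

definition degrees_loaded :: "state \<Rightarrow> nat \<Rightarrow> bool" where
  "degrees_loaded s r \<longleftrightarrow> reg s rOutdeg = length (adj (reg s rCur)) \<and>
     reg s rOff = offset (reg s rCur) \<and> reg s rDeg = positions r (reg s rCur)"

text \<open>Here and for the other modes, the slack 10 in the hypothesis on time covers the part of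
  the iteration already executed: 1 step for the loop test, 6 for the degrees and at most 3 for the
  tests of the mode.\<close>

lemma wp_start_vertex:
  assumes inv: "invariant r D s es ds" and deg: "degrees_loaded s r"
    and path: "path_inv r ds (reg s rCur) (reg s rPos) UNIV fr"
    and st: "stack_at r (mem s) (reg s rTop) fr"
    and time: "t + 30 * (start_cost r (reg s rCur) + path_costs r fr + white_costs ds) \<le> T + 10"
  shows "wp M I start_vertex (walk_inv r D T) s es t"
proof -
  define u where "u = reg s rCur"
  define p where "p = reg s rPos"
  define m where "m = positions r u"
  note facts = path_inv_facts[OF path]
  have regs: "reg s 0 = 0" "reg s 1 = 1" "reg s 2 = 2" "reg s 3 = 4" "reg s 4 = n" "reg s 5 = r"
    "reg s rCur = u" "reg s rPos = p" "reg s rDeg = m"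
    and run: "dfs_run n adj dfs_start es ds" "marks (mem s) ds" "D \<subseteq> set (discovered ds)"
    using inv deg by (simp_all add: invariant_def regs_def u_def p_def m_def degrees_loaded_def)
  have u: "u \<in> {1..n}" and p: "p < m"
    using facts(7) link_less[OF facts(3)] by (simp_all add: u_def p_def m_def)
  have lim: "x \<le> Suc m \<Longrightarrow> x < limit" for x using positions_limit[OF u, of x r] by (simp add: m_def)
  have len: "length (adj u) \<le> m" using length_adj_le[of u] by (simp add: m_def positions_def)
  have path': "path_inv r ds u p UNIV fr" using path by (simp add: u_def p_def)
  show ?thesis
  proof (cases "m \<le> 1")
    case True
    \<comment> \<open>Here \<open>m = 1\<close> and \<open>p = 0\<close>, so no out-edge other than
      that at \<open>p\<close> can exist.\<close>
    have "path_inv r ds u p {p} fr"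
      by (rule path_inv_cong[OF path']) (use True p len in auto)
    moreover have "(3::nat) < limit" using reg_bits by simp
    moreover have "start_cost r u = 2" using True by (simp add: start_cost_def m_def)
    ultimately show ?thesis
      using True regs run st time unfolding start_vertex_def
      by (simp add: wp_Cond wp_Do, intro at_finish[where ds = ds and fr = fr])
        (simp_all add: invariant_def regs_def)
  next
    case False
    define a where "a = reg s rTop"
    define w where "w = bitlength (m - 2)"
    have w: "width r u = w" by (simp add: width_def w_def m_def)
    have a: "a = n + (\<Sum>v \<leftarrow> map fst fr. width r v)"
      using stack_at_size[OF st] by (simp add: a_def)
    have fits: "a + w \<le> mem_words M"
      using stack_fits[OF path'] a w by simp
    have cost: "start_cost r u = advance_cost r u (m - 2) + w + 2"
      using False w by (simp add: start_cost_def m_def)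
    let ?s1 = "s\<lparr>reg := (reg s)(rK := m - 2)\<rparr>"
    have "wp M I grow_loop (wp M I (seq [
        Do (Op Sub rK rDeg rTwo), Do (Move rAddr rTop), write_loop, advance, Do (Const rMode 1)])
        (walk_inv r D T)) ?s1 es (Suc (Suc t))"
    proof (rule wp_mono[OF grow_loop])
      fix s2 :: state and es2 t2
      assume *: "es2 = es \<and> mem s2 = mem ?s1 \<and>
        reg s2 = (reg ?s1)(rK := 0, rTop := reg ?s1 rTop + bitlength (reg ?s1 rK)) \<and>
        t2 = Suc (Suc t) + 1 + 3 * bitlength (reg ?s1 rK)"
      let ?s3 = "s2\<lparr>reg := (reg s2)(rK := m - 2, rAddr := a + w)\<rparr>"
      have r2: "reg s2 = (reg s)(rK := 0, rTop := a + w)"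
        and e2: "es2 = es" "mem s2 = mem s" "t2 = t + 3 + 3 * w"
        using * by (auto simp: a_def w_def)
      have "wp M I write_loop (wp M I (seq [advance, Do (Const rMode 1)]) (walk_inv r D T))
          ?s3 es (Suc (Suc t2))"
      proof (rule wp_mono[OF write_loop])
        fix s4 :: state and es4 t4
        assume *: "es4 = es \<and>
          (\<exists>x. reg s4 = (reg ?s3)(rK := 0, rAddr := reg ?s3 rAddr - bitlength (reg ?s3 rK), rX := x)) \<and>
          counter_at (mem s4) (reg ?s3 rAddr) (reg ?s3 rK) (reg ?s3 rK) \<and>
          (\<forall>j. j < reg ?s3 rAddr - bitlength (reg ?s3 rK) \<or> reg ?s3 rAddr \<le> j \<longrightarrow>
            mem s4 j = mem ?s3 j) \<and>
          t4 = Suc (Suc t2) + 1 + 5 * bitlength (reg ?s3 rK)"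
        then have c4: "counter_at (mem s4) (a + w) (m - 2) (m - 2)"
          and m4: "\<And>j. j < a \<Longrightarrow> mem s4 j = mem s j"
          and t4: "t4 = t + 6 + 8 * w" "es4 = es"
          and "\<exists>x. reg s4 = (reg s)(rTop := a + w, rK := 0, rAddr := a, rX := x)"
          by (auto simp: e2 r2 w_def)
        then obtain x where r4: "reg s4 = (reg s)(rTop := a + w, rK := 0, rAddr := a, rX := x)"
          by blast
        have "walk_inv r D T (s4\<lparr>reg := (reg s4)(rPos := (p + 1) mod m, rMode := 1)\<rparr>) es (t + 10 + 8 * w)"
        proof (rule at_explore[where ds = ds and u = u and c = "m - 2" and fr = fr])
          show "invariant r D (s4\<lparr>reg := (reg s4)(rPos := (p + 1) mod m, rMode := 1)\<rparr>) es ds"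
            using run(1,3) marks_cong[OF run(2), of "mem s4"] regs m4 a
            by (simp add: invariant_def regs_def r4)
          show "path_inv r ds u (((p + 1) mod m + (m - 2) + 1) mod positions r u)
              (insert ((p + 1) mod m) (rest (positions r u) ((p + 1) mod m) (m - 2))) fr"
            unfolding m_def[symmetric] using p False len
            by (subst parent_position_start, simp, simp, subst insert_rest_complete, simp, simp)
              (auto intro: path_inv_cong[OF path'])
          have "stack_at r (mem s4) a fr"
            using m4 st by (auto intro!: stack_at_cong[of r "mem s"] simp: a_def)
          then show "stack_at r (mem (s4\<lparr>reg := (reg s4)(rPos := (p + 1) mod m, rMode := 1)\<rparr>))
              (reg (s4\<lparr>reg := (reg s4)(rPos := (p + 1) mod m, rMode := 1)\<rparr>) rTop)
              ((u, (p + 1) mod m, m - 2) # fr)"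
            using c4 by (simp add: r4 w m_def[symmetric])
          show "t + 10 + 8 * w + 30 * (1 + path_costs r ((u, (p + 1) mod m, m - 2) # fr) +
              white_costs ds) \<le> T"
            using time unfolding u_def[symmetric] by (simp add: cost)
        qed (use regs p False in \<open>simp_all add: r4 m_def[symmetric]\<close>)
        moreover have "t + 10 + 8 * w = Suc (t4 + 3)" by (simp add: t4)
        ultimately show "wp M I (seq [advance, Do (Const rMode 1)]) (walk_inv r D T) s4 es4 t4"
          using regs p lim[of 1] lim[of "Suc m"] False
          by (simp add: wp_Seq wp_Do wp_advance[of _ m p] r4 t4(2))
      qed (use regs fits lim[of "m - 2"] r2 in \<open>simp_all add: w_def\<close>)
      then show "wp M I (seq [Do (Op Sub rK rDeg rTwo), Do (Move rAddr rTop), write_loop, advance,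
          Do (Const rMode 1)]) (walk_inv r D T) s2 es2 t2"
        using regs fits words_less[of "a + w"] lim[of "m - 2"] lim[of m] False
        by (simp add: wp_Seq wp_Do r2 e2(1))
    qed (use regs fits lim[of "m - 2"] in \<open>simp_all add: a_def w_def\<close>)
    then show ?thesis
      using regs lim[of "m - 2"] lim[of m] False unfolding start_vertex_def
      by (simp add: wp_Seq wp_Do wp_Cond)
  qed
qed

lemma wp_explore_edge:
  assumes inv: "invariant r D s es ds" and deg: "degrees_loaded s r"
    and u: "u = reg s rCur" and i: "i = reg s rPos" and m: "m = positions r u"
    and path: "path_inv r ds u ((i + c + 1) mod m) (insert i (rest m i c)) fr"
    and less: "i < m" "c + 1 < m"
    and st: "stack_at r (mem s) (reg s rTop) ((u, i, c) # fr)"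
    and time: "t + 30 * (1 + path_costs r ((u, i, c) # fr) + white_costs ds) \<le> T + 10"
  shows "wp M I (explore_edge so dir) (walk_inv r D T) s es t"
proof -
  note facts = path_inv_facts[OF path]
  have regs: "reg s 0 = 0" "reg s 1 = 1" "reg s 2 = 2" "reg s 3 = 4" "reg s 4 = n" "reg s 5 = r"
    "reg s rCur = u" "reg s rPos = i" "reg s rDeg = m" "reg s rOutdeg = length (adj u)"
    and run: "dfs_run n adj dfs_start es ds" "marks (mem s) ds" "D \<subseteq> set (discovered ds)"
    using inv deg by (simp_all add: invariant_def regs_def u i m degrees_loaded_def)
  have uV: "u \<in> {1..n}" using facts(7) by simp
  have lim2: "(2::nat) < limit" "0 < limit" using reg_bits by simp_all
  have rest: "insert i (rest m i c) - {i} = rest m i c" using not_in_rest[OF less] by auto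
  show ?thesis
  proof (cases "i < length (adj u)")
    case False
    have "path_inv r ds u ((i + c + 1) mod m) (rest m i c) fr"
      by (rule path_inv_cong[OF path]) (use False in auto)
    with False regs run st time lim2 less show ?thesis
      unfolding explore_edge_def
      by (simp add: wp_Cond wp_Do, intro at_advance[where ds = ds and u = u and i = i and c = c and fr = fr])
        (simp_all add: invariant_def regs_def m)
  next
    case True
    define v where "v = adj u ! i"
    have v: "v \<in> {1..n}" using True arrays_subset(1)[OF uV] by (metis nth_mem subsetD v_def)
    have v_lim: "v - Suc 0 < mem_words M" "v < limit" "Suc 0 \<le> v" "v - Suc 0 < limit"
      using v reg_bits by (auto simp: mem_words)
    have head: "access I (Head so) u i = Some v" using access_Head[OF uV True] by (simp add: v_def)
    have mark: "mem s (v - Suc 0) = (if v \<in> set (discovered ds) then 1 else 0)"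
      using run(2) v by (simp add: marks_def)
    have stack: "reg s rTop = n + (\<Sum>v \<leftarrow> map fst ((u, i, c) # fr). width r v)"
      using stack_at_size[OF st] .
    show ?thesis
    proof (cases "v \<in> set (discovered ds)")
      case old: True
      obtain ds' where ds': "dfs_step n adj ds [At_Edge Explore_Old u i] ds'"
        "path_inv r ds' u ((i + c + 1) mod m) (rest m i c) fr" "discovered ds' = discovered ds"
        using explore_old_edge[OF path _ True] old rest by (auto simp: v_def)
      let ?s = "s\<lparr>reg := (reg s)(rNext := v, rAddr := v - Suc 0, rX := Suc 0, rMode := 2)\<rparr>"
      have "invariant r D ?s (es @ [At_Edge Explore_Old u i]) ds'"
        using invariant_step[OF inv ds'(1), of ?s] ds'(3) run(2) regs
        by (simp add: regs_def marks_def)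
      then have "walk_inv r D T ?s (es @ [At_Edge Explore_Old u i]) (t + 7)"
        using st time ds'(2,3) regs less
        by (intro at_advance[where ds = ds' and u = u and i = i and c = c and fr = fr])
          (simp_all add: m white_costs_def)
      moreover have "t + 7 = Suc (Suc (Suc (Suc (Suc (Suc (Suc t))))))" by simp
      ultimately show ?thesis
        using True regs head v_lim lim2 mark old unfolding explore_edge_def
        by (simp add: wp_Cond wp_Do wp_Seq)
    next
      case new: False
      obtain j where j: "j < length (A si v)" "A si v ! j = u" "access I (Mate so) u i = Some j"
        using access_Mate_child[OF uV True] by (auto simp: v_def)
      let ?es = "[At_Edge Explore_New u i, At_Vertex Discover v]"
      obtain ds' where ds': "dfs_step n adj ds ?es ds'"
        "path_inv r ds' v (offset v + j) UNIV ((u, i, c) # fr)" "discovered ds' = v # discovered ds"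
        by (rule explore_new_edge[OF path _ True v_def[symmetric] new _ _ _ j(1,2), of c])
          (use rest less m in auto)
      have j_lim: "j < limit" "offset v < limit" "offset v + j < limit"
        using j(1) positions_limit[OF v, of "offset v + j" r] by (auto simp: positions_def dg_def)
      let ?s = "s\<lparr>mem := (mem s)(v - Suc 0 := Suc 0), reg := (reg s)(rNext := v, rAddr := v - Suc 0,
        rX := 0, rCur := v, rOff := offset v, rPos := j + offset v, rMode := 0)\<rparr>"
      have "invariant r D ?s (es @ ?es) ds'"
        using invariant_step[OF inv ds'(1), of ?s] ds'(3) regs marks_discover[OF run(2) v ds'(3)]
        by (simp add: regs_def subset_insertI)
      moreover have "stack_at r ((mem s)(v - Suc 0 := Suc 0)) (reg s rTop) ((u, i, c) # fr)"
        by (rule stack_at_cong[OF st]) (use v in auto)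
      \<comment> \<open>The unit held by mode 1 covers these 13 steps and the slack of 10; the white
        cost of \<open>v\<close> turns into its start cost.\<close>
      moreover have "t + 13 + 30 * (start_cost r v + path_costs r ((u, i, c) # fr) + white_costs ds') \<le> T"
        using time start_cost_le[of r v] white_costs_discover[OF v new ds'(3)] by simp
      ultimately have "walk_inv r D T ?s (es @ ?es) (t + 13)"
        using ds'(2) regs by (intro at_start[where ds = ds' and fr = "(u, i, c) # fr"]) (simp_all add: add.commute)
      moreover have "t + 13 = Suc (Suc (Suc (Suc (Suc (Suc (Suc (Suc (Suc (Suc (Suc (Suc (Suc t))))))))))))" by simp
      ultimately show ?thesis
        using True regs head v_lim lim2 mark new j(3) j_lim v mem_bits unfolding explore_edge_def
        by (simp add: wp_Cond wp_Do wp_Seq wp_get_offset add.commute)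
    qed
  qed
qed

lemma wp_next_position:
  assumes inv: "invariant r D s es ds" and deg: "degrees_loaded s r"
    and u: "u = reg s rCur" and i: "i = reg s rPos" and m: "m = positions r u"
    and path: "path_inv r ds u ((i + c + 1) mod m) (rest m i c) fr"
    and less: "i < m" "c + 1 < m"
    and st: "stack_at r (mem s) (reg s rTop) ((u, i, c) # fr)"
    and time: "t + 30 * (path_costs r ((u, i, c) # fr) + white_costs ds) \<le> T + 10"
  shows "wp M I next_position (walk_inv r D T) s es t"
proof -
  note facts = path_inv_facts[OF path]
  have regs: "reg s 0 = 0" "reg s 1 = 1" "reg s 2 = 2" "reg s 3 = 4" "reg s 4 = n" "reg s 5 = r"
    "reg s rCur = u" "reg s rPos = i" "reg s rDeg = m"
    and run: "dfs_run n adj dfs_start es ds" "marks (mem s) ds" "D \<subseteq> set (discovered ds)"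
    using inv deg by (simp_all add: invariant_def regs_def u i m degrees_loaded_def)
  have uV: "u \<in> {1..n}" using facts(7) by simp
  have lim: "x \<le> Suc m \<Longrightarrow> x < limit" for x using positions_limit[OF uV, of x r] by (simp add: m)
  have lim3: "(3::nat) < limit" using reg_bits by simp
  define a where "a = reg s rTop"
  define w where "w = bitlength (m - 2)"
  have w: "width r u = w" by (simp add: width_def w_def m)
  have stack: "a = n + w + (\<Sum>v \<leftarrow> map fst fr. width r v)"
    using stack_at_size[OF st] by (simp add: a_def w)
  have fits: "a \<le> mem_words M" using stack_fits[OF path] stack w by simp
  have below: "w \<le> a" "stack_at r (mem s) (a - w) fr" "counter_at (mem s) a (m - 2) c"
    using st by (simp_all add: a_def w m)
  let ?s1 = "s\<lparr>reg := (reg s)(rK := m - 2, rAddr := a, rFlag := 0)\<rparr>"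
  have "wp M I decrement_loop (wp M I (seq [advance,
      Cond (Eq rFlag rZero) (seq [Do (Move rTop rAddr), Do (Const rMode 3)]) (Do (Const rMode 1))])
      (walk_inv r D T)) ?s1 es (Suc (Suc (Suc t)))"
  proof (rule wp_mono[OF decrement_loop[where c = c]])
    fix s2 :: state and es2 t2
    assume *: "es2 = es \<and>
     (\<exists>x a'. reg s2 = (reg ?s1)(rK := 0, rX := x, rAddr := a', rFlag := (if c = 0 then reg ?s1 rFlag else 1)) \<and>
        (c = 0 \<longrightarrow> a' = reg ?s1 rAddr - bitlength (reg ?s1 rK))) \<and>
     (c \<noteq> 0 \<longrightarrow> counter_at (mem s2) (reg ?s1 rAddr) (reg ?s1 rK) (c - 1)) \<and>
     (\<forall>j. j < reg ?s1 rAddr - bitlength (reg ?s1 rK) \<or> reg ?s1 rAddr \<le> j \<longrightarrow> mem s2 j = mem ?s1 j) \<and>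
     (if c = 0 then t2 \<le> Suc (Suc (Suc t)) + 1 + 7 * bitlength (reg ?s1 rK)
      else t2 + 7 * dec_cost (c - 1) \<le> Suc (Suc (Suc t)) + 1 + 7 * dec_cost c)"
    then obtain x a' where reg2: "reg s2 = (reg ?s1)(rK := 0, rX := x, rAddr := a',
        rFlag := (if c = 0 then reg ?s1 rFlag else 1))"
      and "c = 0 \<longrightarrow> a' = reg ?s1 rAddr - bitlength (reg ?s1 rK)" by blast
    then have a': "c = 0 \<Longrightarrow> a' = a - w" by (simp add: w_def)
    have r2: "reg s2 = (reg s)(rK := 0, rX := x, rAddr := a', rFlag := (if c = 0 then 0 else 1))"
      unfolding reg2 by auto
    from * have e2: "es2 = es" and c2: "c \<noteq> 0 \<Longrightarrow> counter_at (mem s2) a (m - 2) (c - 1)"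
      and m2: "\<And>j. j < a - w \<Longrightarrow> mem s2 j = mem s j"
      and t2: "if c = 0 then t2 \<le> t + 4 + 7 * w else t2 + 7 * dec_cost (c - 1) \<le> t + 4 + 7 * dec_cost c"
      by (auto simp: w_def split: if_splits)
    have mk: "marks (mem s2) ds" using marks_cong[OF run(2), of "mem s2"] m2 stack by simp
    have st2: "stack_at r (mem s2) (a - w) fr"
      using stack_at_cong[OF below(2), of "mem s2"] m2 by simp
    let ?i = "(i + 1) mod m"
    have adv: "wp M I advance Q s2 es2 t2 \<longleftrightarrow> Q (s2\<lparr>reg := (reg s2)(rPos := ?i)\<rparr>) es (t2 + 3)" for Q
      using regs less lim[of "Suc m"] r2 e2 by (simp add: wp_advance[of _ m i])
    show "wp M I (seq [advance, Cond (Eq rFlag rZero) (seq [Do (Move rTop rAddr),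
        Do (Const rMode 3)]) (Do (Const rMode 1))]) (walk_inv r D T) s2 es2 t2"
    proof (cases "c = 0")
      case True
      let ?s = "s2\<lparr>reg := (reg s2)(rPos := ?i, rTop := a - w, rMode := 3)\<rparr>"
      have "walk_inv r D T ?s es (t2 + 6)"
      proof (rule at_finish[where ds = ds and fr = fr])
        show "invariant r D ?s es ds"
          using run mk regs r2 by (simp add: invariant_def regs_def)
        \<comment> \<open>With \<open>c = 0\<close> the only position left is
          \<open>(i + 1) mod m\<close>, which is that of the parent.\<close>
        show "path_inv r ds (reg ?s rCur) (reg ?s rPos) {reg ?s rPos} fr"
          using path True regs r2 by (simp add: rest_0)
        show "t2 + 6 + 30 * (1 + path_costs r fr + white_costs ds) \<le> T"
          using time t2 True by (simp add: advance_cost_def w)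
      qed (use st2 in simp_all)
      moreover have "t2 + 6 = Suc (Suc (Suc (t2 + 3)))" by simp
      ultimately show ?thesis
        using True adv regs r2 a' lim3 fits words_less[of "a - w"]
        by (simp add: wp_Seq wp_Cond wp_Do)
    next
      case False
      let ?s = "s2\<lparr>reg := (reg s2)(rPos := ?i, rMode := 1)\<rparr>"
      obtain b where b: "c = Suc b" using False by (cases c) auto
      have "walk_inv r D T ?s es (t2 + 5)"
      proof (rule at_explore[where ds = ds and fr = fr and u = u and i = ?i and c = b])
        show "invariant r D ?s es ds"
          using run mk regs r2 by (simp add: invariant_def regs_def)
        \<comment> \<open>Mode 2 at \<open>i\<close> with counter \<open>Suc b\<close> and mode 1 at
          the next position with counter \<open>b\<close> describe the same pending set and the same
          parent position.\<close>
        show "path_inv r ds u ((?i + b + 1) mod positions r u)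
            (insert ?i (rest (positions r u) ?i b)) fr"
          using path unfolding b m[symmetric] rest_Suc parent_position_step .
        show "t2 + 5 + 30 * (1 + path_costs r ((u, ?i, b) # fr) + white_costs ds) \<le> T"
          using time t2 False dec_cost_mono[of b "Suc b"] by (simp add: advance_cost_def b)
        show "stack_at r (mem ?s) (reg ?s rTop) ((u, ?i, b) # fr)"
          using st2 below c2 False r2 by (simp add: w b m[symmetric] a_def)
      qed (use regs r2 less in \<open>simp_all add: m[symmetric] b\<close>)
      moreover have "t2 + 5 = Suc (Suc (t2 + 3))" by simp
      ultimately show ?thesis
        using False adv regs r2 lim3
        by (simp add: wp_Seq wp_Cond wp_Do)
    qed
  qed (use regs below fits less lim[of "m - 2"] in \<open>simp_all add: w_def\<close>)
  then show ?thesis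
    using regs lim[of "m - 2"] lim[of m] less fits words_less[of a] lim3 unfolding next_position_def
    by (simp add: wp_Seq wp_Do a_def)
qed

text \<open>Up to two steps of the DFS happen here: the exploration of the edge back to the parent,
  if the graph is undirected and the vertex is not a root, and the finish.\<close>

lemma wp_finish_vertex:
  assumes inv: "invariant r D s es ds" and deg: "degrees_loaded s r"
    and u: "u = reg s rCur" and p: "p = reg s rPos"
    and path: "path_inv r ds u p {p} fr"
    and st: "stack_at r (mem s) (reg s rTop) fr"
    and time: "t + 30 * (1 + path_costs r fr + white_costs ds) \<le> T + 10"
  shows "wp M I (finish_vertex si) (walk_inv r D T) s es t"
proof -
  note facts = path_inv_facts[OF path]
  have regs: "reg s 0 = 0" "reg s 1 = 1" "reg s 2 = 2" "reg s 3 = 4" "reg s 4 = n" "reg s 5 = r"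
    "reg s rCur = u" "reg s rPos = p" "reg s rOutdeg = length (adj u)" "reg s rOff = offset u"
    and run: "dfs_run n adj dfs_start es ds" "marks (mem s) ds" "D \<subseteq> set (discovered ds)"
    using inv deg by (simp_all add: invariant_def regs_def u p degrees_loaded_def)
  have uV: "u \<in> {1..n}" using facts(7) by simp
  have lim4: "(4::nat) < limit" "2 < limit" using reg_bits size_pos by simp_all
  have p_lim: "p < limit" using positions_limit[OF uV, of p r] link_less[OF facts(3)] by simp
  define es1 where "es1 = (if p < length (adj u) then [At_Edge Explore_Old u p] else [])"
  obtain ds1 where ds1: "invariant r D s (es @ es1) ds1" "path_inv r ds1 u p {} fr"
    "discovered ds1 = discovered ds"
  proof (cases "p < length (adj u)")
    case True
    obtain ds1 where "dfs_step n adj ds [At_Edge Explore_Old u p] ds1"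
      "path_inv r ds1 u p {} fr" "discovered ds1 = discovered ds"
      using explore_old_edge[OF path _ True parent_edge_old[OF path True]] by auto
    then show ?thesis
      using that[of ds1] invariant_step[OF inv, of _ ds1 s] True regs run(2)
      by (simp add: es1_def regs_def marks_def)
  next
    case False
    have "path_inv r ds u p {} fr" by (rule path_inv_cong[OF path]) (use False in auto)
    then show ?thesis using that[of ds] inv False by (simp add: es1_def)
  qed
  define es2 where "es2 = At_Vertex Finish u #
       (case fr of [] \<Rightarrow> [] | (v, i, _) # _ \<Rightarrow> [At_Edge Withdraw v i])"
  obtain ds2 where ds2: "dfs_step n adj ds1 es2 ds2" "discovered ds2 = discovered ds1" "base_inv ds2"
    "fr = [] \<Longrightarrow> set (discovered ds2) \<subseteq> black ds2"
    "\<And>v i c fr'. fr = (v, i, c) # fr' \<Longrightarrow>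
      path_inv r ds2 v ((i + c + 1) mod positions r v) (rest (positions r v) i c) fr'"
    using finish_current[OF ds1(2)] unfolding es2_def by blast
  have inv2: "invariant r D s' (es @ es1 @ es2) ds2" if "regs s' r" "mem s' = mem s" for s'
    using invariant_step[OF ds1(1) ds2(1) that(1)] run(2) ds1(3) ds2(2) that(2)
    by (simp add: marks_def)
  have wc: "white_costs ds2 = white_costs ds" by (simp add: white_costs_def ds1(3) ds2(2))
  have link: "link r ds u p fr" using facts(3) .
  have first: "wp M I (Cond (Less rPos rOutdeg) (Do (Invoke_Edge Explore_Old rCur rPos)) skip) Q s es t \<longleftrightarrow>
      Q s (es @ es1) (Suc (Suc t))" for Q
    using regs by (simp add: wp_Cond wp_Do wp_skip es1_def)
  show ?thesis
  proof (cases fr)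
    case Nil
    let ?s = "s\<lparr>reg := (reg s)(rMode := 4)\<rparr>"
    have "u = r" using link Nil by (simp add: link_def)
    have "invariant r D ?s (es @ es1 @ es2) ds2"
      using regs by (intro inv2) (simp_all add: regs_def)
    then have "walk_inv r D T ?s (es @ es1 @ es2) (t + 5)"
      using ds2(3,4) Nil st time wc by (intro at_end[where ds = ds2]) simp_all
    moreover have "t + 5 = Suc (Suc (Suc (Suc (Suc t))))" by simp
    ultimately show ?thesis
      using regs lim4 \<open>u = r\<close> Nil unfolding finish_vertex_def
      by (simp add: wp_Seq first, simp add: wp_Cond wp_Do es2_def)
  next
    case (Cons f fr')
    obtain v i c where f: "f = (v, i, c)" by (cases f)
    have l: "u \<noteq> r" "offset u \<le> p" "p - offset u < length (A si u)" "A si u ! (p - offset u) = v"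
      "i < length (adj v)" "adj v ! i = u"
      using link Cons f by (auto simp: link_def)
    have vV: "v \<in> {1..n}" using facts(7) Cons f by simp
    have acc: "access I (Head si) u (p - offset u) = Some v" "access I (Mate si) u (p - offset u) = Some i"
      using access_Head[OF uV l(3)] access_Mate_parent[OF uV vV l(3-6)] l(4) by simp_all
    have i_m: "i < positions r v" using l(5) length_adj_le[of v] by (simp add: positions_def)
    have v_lim: "v < limit" "i < limit" "p - offset u < limit"
      using vV reg_bits positions_limit[OF vV, of i r] i_m p_lim by auto
    let ?s = "s\<lparr>reg := (reg s)(rX := p - offset u, rNext := v, rPos := i, rCur := v, rMode := 2)\<rparr>"
    have "invariant r D ?s (es @ es1 @ es2) ds2"
      using regs by (intro inv2) (simp_all add: regs_def)
    moreover have "c + 1 < positions r v" using facts(4) Cons f by simp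
    ultimately have "walk_inv r D T ?s (es @ es1 @ es2) (t + 10)"
      using ds2(5) Cons f st time wc i_m
      by (intro at_advance[where ds = ds2 and u = v and i = i and c = c and fr = fr']) simp_all
    moreover have "t + 10 = Suc (Suc (Suc (Suc (Suc (Suc (Suc (Suc (Suc (Suc t)))))))))" by simp
    ultimately show ?thesis
      using regs lim4 l(1,2) Cons f acc v_lim p_lim unfolding finish_vertex_def
      by (simp add: wp_Seq first, simp add: wp_Cond wp_Do wp_Seq es2_def)
  qed
qed

lemma wp_walk_body:
  assumes "walk_inv r D T s es t" "reg s rMode < 4"
  shows "wp M I (walk_body so si dir) (walk_inv r D T) s es (t + 1)"
proof -
  let ?s = "s\<lparr>reg := (reg s)(rOutdeg := length (adj (reg s rCur)), rOff := offset (reg s rCur),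
    rX := length (A si (reg s rCur)), rDeg := positions r (reg s rCur))\<rparr>"
  have deg: "degrees_loaded ?s r" by (simp add: degrees_loaded_def)
  have inv': "invariant r D ?s es ds" if "invariant r D s es ds" for ds
    using that by (simp add: invariant_def regs_def)
  have body: "wp M I (walk_body so si dir) (walk_inv r D T) s es (t + 1) \<longleftrightarrow>
      wp M I (Cond (Eq rMode rZero) start_vertex (Cond (Eq rMode rOne) (explore_edge so dir)
         (Cond (Eq rMode rTwo) next_position (finish_vertex si)))) (walk_inv r D T) ?s es (t + 7)"
    if "invariant r D s es ds" "reg s rCur \<in> {1..n}" for ds
  proof -
    have "regs s r" using that(1) by (simp add: invariant_def)
    moreover have "t + 7 = t + 1 + 6" by simp
    ultimately show ?thesis unfolding walk_body_def using that(2)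
      by (simp only: seq.simps wp_Seq wp_get_degrees[OF _ refl])
  qed
  have cond: "reg s 0 = 0" "reg s (Suc 0) = Suc 0" "reg s 2 = 2" if "invariant r D s es ds" for ds
    using that by (simp_all add: invariant_def regs_def)
  from assms(1) show ?thesis
  proof cases
    case (at_start ds fr)
    have "wp M I start_vertex (walk_inv r D T) ?s es (t + 8)"
      by (rule wp_start_vertex[OF inv'[OF at_start(1)] deg]) (use at_start in auto)
    moreover have "t + 8 = Suc (t + 7)" by simp
    ultimately show ?thesis
      using path_inv_facts(7)[OF at_start(3)] cond[OF at_start(1)] at_start(2)
      by (subst body[OF at_start(1)]) (simp_all add: wp_Cond)
  next
    case (at_explore ds u i c fr)
    have "wp M I (explore_edge so dir) (walk_inv r D T) ?s es (t + 9)"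
      by (rule wp_explore_edge[OF inv'[OF at_explore(1)] deg, where u = u and i = i and c = c and fr = fr])
        (use at_explore in auto)
    moreover have "t + 9 = Suc (Suc (t + 7))" by simp
    ultimately show ?thesis
      using path_inv_facts(7)[OF at_explore(5)] cond[OF at_explore(1)] at_explore(2,3)
      by (subst body[OF at_explore(1)]) (simp_all add: wp_Cond)
  next
    case (at_advance ds u i c fr)
    have "wp M I next_position (walk_inv r D T) ?s es (t + 10)"
      by (rule wp_next_position[OF inv'[OF at_advance(1)] deg, where u = u and i = i and c = c and fr = fr])
        (use at_advance in auto)
    moreover have "t + 10 = Suc (Suc (Suc (t + 7)))" by simp
    ultimately show ?thesis
      using path_inv_facts(7)[OF at_advance(5)] cond[OF at_advance(1)] at_advance(2,3)
      by (subst body[OF at_advance(1)]) (simp_all add: wp_Cond)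
  next
    case (at_finish ds fr)
    have "wp M I (finish_vertex si) (walk_inv r D T) ?s es (t + 10)"
      by (rule wp_finish_vertex[OF inv'[OF at_finish(1)] deg refl refl, where fr = fr])
        (use at_finish in auto)
    moreover have "t + 10 = Suc (Suc (Suc (t + 7)))" by simp
    ultimately show ?thesis
      using path_inv_facts(7)[OF at_finish(3)] cond[OF at_finish(1)] at_finish(2)
      by (subst body[OF at_finish(1)]) (simp_all add: wp_Cond)
  next
    case (at_end ds)
    with assms(2) show ?thesis by simp
  qed
qed

section \<open>The loop over the roots and the whole program\<close>

definition root_inv :: "nat \<Rightarrow> state \<Rightarrow> event list \<Rightarrow> nat \<Rightarrow> bool" where
  "root_inv T s es t \<longleftrightarrow> (\<exists>ds r. invariant r {1..r} s es ds \<and> base_inv ds \<and>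
     set (discovered ds) \<subseteq> black ds \<and> r \<le> n \<and> reg s rTop = n \<and>
     t + 30 * (white_costs ds + 2 * (n - r)) \<le> T)"

text \<open>The deadline \<open>T'\<close> of one tree leaves out of \<open>T\<close> the 60 steps
  reserved for each remaining root and the last test of the walk.\<close>

lemma wp_walk:
  assumes "walk_inv r {1..r} T' s es t" "r \<le> n" "T' + 1 + 60 * (n - r) \<le> T"
  shows "wp M I (While (Less rMode rFour) (walk_body so si dir)) (root_inv T) s es t"
proof -
  have "wp M I (While (Less rMode rFour) (walk_body so si dir))
      (\<lambda>s es t. \<not> test_value (Less rMode rFour) s \<and> (\<exists>t'. t = t' + 1 \<and> walk_inv r {1..r} T' s es t')) s es t"
  proof (rule wp_While_bounded[where J = "walk_inv r {1..r} T'" and T = T'])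
    show "walk_inv r {1..r} T' s es t" by (rule assms(1))
    show "t \<le> T'" if "walk_inv r {1..r} T' s es t" for s es t
      using that by cases auto
    show "wp M I (walk_body so si dir) (walk_inv r {1..r} T') s es (t + 1)"
      if "walk_inv r {1..r} T' s es t" "test_value (Less rMode rFour) s" for s es t
    proof (rule wp_walk_body[OF that(1)])
      from that(1) have "reg s rFour = 4" by cases (auto simp: invariant_def regs_def)
      with that(2) show "reg s rMode < 4" by simp
    qed
  qed
  then show ?thesis
  proof (rule wp_mono)
    fix s' es' t'
    assume "\<not> test_value (Less rMode rFour) s' \<and> (\<exists>t''. t' = t'' + 1 \<and> walk_inv r {1..r} T' s' es' t'')"
    then obtain t'' where t'': "t' = t'' + 1" and "walk_inv r {1..r} T' s' es' t''"
      and mode: "\<not> reg s' rMode < reg s' rFour" by auto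
    from this(2) show "root_inv T s' es' t'"
    proof cases
      case (at_end ds)
      with t'' assms(2,3) show ?thesis unfolding root_inv_def
        by (intro exI[of _ ds] exI[of _ r]) auto
    qed (use mode in \<open>auto simp: invariant_def regs_def\<close>)
  qed
qed

lemma wp_root_body:
  assumes "root_inv T s es t" "reg s rRoot < n"
  shows "wp M I (root_body so si dir) (root_inv T) s es (t + 1)"
proof -
  obtain ds r where inv: "invariant r {1..r} s es ds" "base_inv ds"
    "set (discovered ds) \<subseteq> black ds" "r \<le> n" "reg s rTop = n"
    and time: "t + 30 * (white_costs ds + 2 * (n - r)) \<le> T"
    using assms(1) unfolding root_inv_def by blast
  have regs: "reg s 0 = 0" "reg s 1 = 1" "reg s 2 = 2" "reg s 3 = 4" "reg s 4 = n" "reg s 5 = r"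
    and run: "dfs_run n adj dfs_start es ds" "marks (mem s) ds" "{1..r} \<subseteq> set (discovered ds)"
    using inv by (simp_all add: invariant_def regs_def)
  let ?r = "Suc r"
  have r: "r < n" "?r \<in> {1..n}" using assms(2) regs by auto
  have lim: "?r < limit" "r < limit" "1 < limit" "r < mem_words M"
    using r reg_bits by (auto simp: mem_words)
  have insert_r: "{1..?r} = insert ?r {1..r}" by auto
  have mark: "mem s r = (if ?r \<in> set (discovered ds) then 1 else 0)"
    using run(2) r(2) unfolding marks_def by (metis diff_Suc_1)
  show ?thesis
  proof (cases "?r \<in> set (discovered ds)")
    case True
    let ?s = "s\<lparr>reg := (reg s)(rAddr := r, rRoot := ?r, rX := 1)\<rparr>"
    have "invariant ?r {1..?r} ?s es ds"
      unfolding insert_r using run regs True by (simp add: invariant_def regs_def)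
    then have "root_inv T ?s es (t + 6)"
      using inv r time unfolding root_inv_def
      by (intro exI[of _ ds] exI[of _ ?r]) auto
    moreover have "t + 6 = Suc (Suc (Suc (Suc (Suc (Suc t)))))" by simp
    ultimately show ?thesis
      using regs lim mark True unfolding root_body_def
      by (simp add: wp_Seq wp_Do wp_Cond wp_skip)
  next
    case False
    obtain ds' where ds': "dfs_step n adj ds [At_Vertex Discover ?r] ds'"
      "path_inv ?r ds' ?r (dg ?r) UNIV []" "discovered ds' = ?r # discovered ds"
      using discover_root[OF inv(2,3) r(2) False] by blast
    let ?s = "s\<lparr>mem := (mem s)(r := 1), reg := (reg s)(rAddr := r, rRoot := ?r, rCur := ?r,
      rOff := offset ?r, rX := length (A si ?r), rPos := dg ?r, rMode := 0)\<rparr>"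
    have "dfs_run n adj dfs_start (es @ [At_Vertex Discover ?r]) ds'"
      using run(1) ds'(1) by (rule dfs_run_snoc)
    then have "invariant ?r {1..?r} ?s (es @ [At_Vertex Discover ?r]) ds'"
      unfolding insert_r using marks_discover[OF run(2) r(2) ds'(3)] run(3) ds'(3) regs
      by (auto simp: invariant_def regs_def)
    \<comment> \<open>The white cost of the new root turns into its start cost; the 60 steps
      reserved for this root cover its discovery.\<close>
    moreover have "t + 13 + 30 * (start_cost ?r ?r + white_costs ds') \<le> T - 1 - 60 * (n - ?r)"
      using time r(1) start_cost_le[of ?r ?r] white_costs_discover[OF r(2) False ds'(3)] by simp
    ultimately have "walk_inv ?r {1..?r} (T - 1 - 60 * (n - ?r)) ?s (es @ [At_Vertex Discover ?r]) (t + 12)"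
      using ds'(2) inv(5) by (intro at_start[where ds = ds' and fr = "[]"]) simp_all
    moreover have "1 + 60 * (n - ?r) \<le> T" using time r(1) by simp
    ultimately have "wp M I (While (Less rMode rFour) (walk_body so si dir)) (root_inv T) ?s
        (es @ [At_Vertex Discover ?r]) (t + 12)"
      using r by (intro wp_walk) auto
    moreover have "t + 12 = Suc (Suc (Suc (Suc (Suc (Suc (Suc (Suc (Suc (Suc (Suc (Suc t)))))))))))" by simp
    moreover have "length (A si ?r) < limit" "dg ?r < limit" "offset ?r < limit"
      using length_array_le[OF r(2)] reg_bits dg_le[OF r(2)] by (auto simp: dg_def)
    ultimately show ?thesis
      using regs lim mark False r mem_bits unfolding root_body_def
      by (simp add: wp_Seq wp_Do wp_Cond wp_get_offset access_Deg fun_upd_twist dg_def)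
  qed
qed

theorem wp_dfs_program:
  "wp M I (dfs_program so si dir)
     (\<lambda>s es t. is_DFS n adj es \<and> t \<le> 6 + 30 * ((\<Sum>v \<in> {1..n}. white_cost v) + 2 * n)) initial_state [] 0"
proof -
  \<comment> \<open>Five steps of initialization; the sixth step in the claim is the last test of
    the root loop.\<close>
  let ?T = "5 + 30 * ((\<Sum>v \<in> {1..n}. white_cost v) + 2 * n)"
  let ?s = "initial_state\<lparr>reg := (reg initial_state)(rOne := 1, rTwo := 2, rFour := 4, rSize := n, rTop := n)\<rparr>"
  let ?t = "Suc (Suc (Suc (Suc (Suc 0))))"
  have lim: "(1::nat) < limit" "(2::nat) < limit" "(4::nat) < limit" "n < limit"
    using reg_bits size_pos by simp_all
  have "base_inv dfs_start"
    by (simp add: base_inv_def dfs_start_def pending_def)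
  moreover have "invariant 0 {1..0} ?s [] dfs_start"
    using dfs_run_Nil[of n adj dfs_start]
    by (simp add: invariant_def regs_def marks_def initial_state_def dfs_start_def)
  moreover have "white_costs dfs_start = (\<Sum>v \<in> {1..n}. white_cost v)"
    by (simp add: white_costs_def dfs_start_def)
  ultimately have init: "root_inv ?T ?s [] ?t"
    unfolding root_inv_def by (intro exI[of _ dfs_start] exI[of _ 0]) (simp add: dfs_start_def)
  have "wp M I (While (Less rRoot rSize) (root_body so si dir))
      (\<lambda>s es t. \<not> test_value (Less rRoot rSize) s \<and> (\<exists>t'. t = t' + 1 \<and> root_inv ?T s es t')) ?s [] ?t"
  proof (rule wp_While_bounded[where J = "root_inv ?T" and T = ?T])
    show "root_inv ?T ?s [] ?t" by (rule init)
    show "t \<le> ?T" if "root_inv ?T s es t" for s es t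
      using that unfolding root_inv_def by auto
    show "wp M I (root_body so si dir) (root_inv ?T) s es (t + 1)"
      if "root_inv ?T s es t" "test_value (Less rRoot rSize) s" for s es t
      using that by (intro wp_root_body) (auto simp: root_inv_def invariant_def regs_def)
  qed
  then have "wp M I (While (Less rRoot rSize) (root_body so si dir))
      (\<lambda>s es t. is_DFS n adj es \<and> t \<le> 6 + 30 * ((\<Sum>v \<in> {1..n}. white_cost v) + 2 * n)) ?s [] ?t"
  proof (rule wp_mono)
    fix s es t
    assume *: "\<not> test_value (Less rRoot rSize) s \<and> (\<exists>t'. t = t' + 1 \<and> root_inv ?T s es t')"
    then obtain t' ds r where t': "t = t' + 1" and "invariant r {1..r} s es ds" "base_inv ds"
      "set (discovered ds) \<subseteq> black ds" "r \<le> n" "t' \<le> ?T" "\<not> reg s rRoot < reg s rSize"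
      unfolding root_inv_def by auto
    moreover from this have "r = n" by (simp add: invariant_def regs_def)
    ultimately have "dfs_run n adj dfs_start es ds" "black ds = {1..n}"
      by (auto simp: invariant_def base_inv_def)
    then show "is_DFS n adj es \<and> t \<le> 6 + 30 * ((\<Sum>v \<in> {1..n}. white_cost v) + 2 * n)"
      using t' \<open>t' \<le> ?T\<close> by (auto simp: is_DFS_def)
  qed
  then show ?thesis
    using lim unfolding dfs_program_def
    by (simp add: wp_Seq wp_Do size_I initial_state_def)
qed

end

section \<open>Bounds on the space\<close>

lemma less_power_bitlength: "k < 2 ^ bitlength k"
proof (induction k rule: bitlength.induct)
  case (1 k)
  show ?case
  proof (cases "k = 0")
    case False
    with 1 have "k div 2 < 2 ^ bitlength (k div 2)" by simp
    then have "k < 2 * 2 ^ bitlength (k div 2)" by linarith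
    with False show ?thesis by (simp add: bitlength_pos)
  qed simp
qed

lemma power_bitlength_le: "0 < k \<Longrightarrow> 2 ^ (bitlength k - 1) \<le> k"
proof (induction k rule: bitlength.induct)
  case (1 k)
  show ?case
  proof (cases "k = 1")
    case True
    then show ?thesis by (simp add: bitlength_pos)
  next
    case False
    with 1 have IH: "2 ^ (bitlength (k div 2) - 1) \<le> k div 2" by simp
    have "bitlength (k div 2) = Suc (bitlength (k div 2 div 2))"
      using False 1(2) by (intro bitlength_pos) linarith
    then have "2 ^ (bitlength k - 1) = 2 * 2 ^ (bitlength (k div 2) - 1)"
      using 1(2) by (simp add: bitlength_pos[of k])
    also have "\<dots> \<le> k" using IH by linarith
    finally show ?thesis .
  qed
qed

text \<open>A number \<open>d - 2\<close> of \<open>b\<close> bits lies between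
  \<open>2 ^ (b - 1)\<close> and \<open>2 ^ b - 1\<close>; adding 1 moves the strict inequality to
  the lower end, which is the characterization of a ceiling.\<close>

lemma ceiling_log_bitlength:
  assumes "3 \<le> d"
  shows "\<lceil>log 2 (real d - 1)\<rceil> = int (bitlength (d - 2))"
proof (rule ceiling_unique)
  let ?b = "bitlength (d - 2)"
  have pos: "0 < d - 2" using assms by simp
  have b: "?b = Suc (?b - 1)" using bitlength_pos[OF pos] by simp
  have "2 ^ (?b - 1) \<le> d - 2" using pos by (rule power_bitlength_le)
  then have "2 ^ (?b - 1) < d - 1" using pos by linarith
  then have "real (2 ^ (?b - 1)) < real (d - 1)" by (simp only: of_nat_less_iff)
  then have "2 powr real (?b - 1) < real d - 1"
    using assms by (simp add: powr_realpow)
  then have "real (?b - 1) < log 2 (real d - 1)" using assms by (simp add: less_log_iff)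
  then show "real_of_int (int ?b) - 1 < log 2 (real d - 1)"
    by (subst b) simp
  have "d - 2 < 2 ^ ?b" by (rule less_power_bitlength)
  then have "d - 1 \<le> 2 ^ ?b" using pos by linarith
  then have "real (d - 1) \<le> real (2 ^ ?b)" by (simp only: of_nat_le_iff)
  then have "real d - 1 \<le> 2 powr real ?b"
    using assms by (simp add: powr_realpow)
  then show "log 2 (real d - 1) \<le> real_of_int (int ?b)" using assms by (simp add: log_le_iff)
qed

text \<open>Vertices of degree at most 2 contribute 0 by truncated subtraction.\<close>

lemma L_minus_1_eq: "L_minus_1 n d = int (\<Sum>v \<in> {1..n}. bitlength (d v - 2))"
proof -
  have "L_minus_1 n d = (\<Sum>v \<in> {v \<in> {1..n}. d v \<ge> 3}. int (bitlength (d v - 2)))"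
    unfolding L_minus_1_def by (intro sum.cong) (auto simp: ceiling_log_bitlength)
  also have "\<dots> = (\<Sum>v \<in> {1..n}. int (bitlength (d v - 2)))"
  proof (rule sum.mono_neutral_left)
    show "\<forall>v \<in> {1..n} - {v \<in> {1..n}. d v \<ge> 3}. int (bitlength (d v - 2)) = 0"
    proof
      fix v assume "v \<in> {1..n} - {v \<in> {1..n}. d v \<ge> 3}"
      then have "d v - 2 = 0" by auto
      then show "int (bitlength (d v - 2)) = 0" by simp
    qed
  qed auto
  finally show ?thesis by simp
qed

text \<open>Halving \<open>k\<close> lowers the left side by 2 and, for \<open>k \<ge> 3\<close>,
  the right side by at least 2. Equality holds at 2 and 4.\<close>

lemma bitlength_le_half: "2 * bitlength k \<le> k + 2"
proof (induction k rule: bitlength.induct)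
  case (1 k)
  consider "k = 0" | "k = 1" | "k = 2" | "3 \<le> k" by linarith
  then show ?case
  proof cases
    case 4
    with 1 show ?thesis using bitlength_pos[of k] by simp
  qed (simp_all add: bitlength_pos)
qed

lemma sum_bitlength_le_edges:
  assumes "(\<Sum>v \<in> {1..n}. d v) = 2 * m"
  shows "(\<Sum>v \<in> {1..n}. bitlength (d v - 2)) \<le> m"
proof -
  have "2 * bitlength (k - 2) \<le> k" for k
    using bitlength_le_half[of "k - 2"] by (cases "2 \<le> k") simp_all
  then have "(\<Sum>v \<in> {1..n}. 2 * bitlength (d v - 2)) \<le> (\<Sum>v \<in> {1..n}. d v)"
    by (intro sum_mono) blast
  with assms show ?thesis by (simp add: sum_distrib_left[symmetric])
qed

text \<open>The successor accounts for the mark of the vertex. The argument of the logarithm is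
  linear in \<open>d\<close>, so that its mean over all vertices is 2 + 8m/n; its summand 2 serves
  degree 0, where both sides are 1.\<close>

lemma Suc_bitlength_le_log: "real (Suc (bitlength (d - 2))) \<le> log 2 (2 + 4 * real d)"
proof -
  have "2 ^ Suc (bitlength (d - 2)) \<le> 2 + 4 * d"
  proof (cases "3 \<le> d")
    case True
    then have "0 < d - 2" by simp
    from power_bitlength_le[OF this] bitlength_pos[OF this]
    have "2 ^ bitlength (d - 2) \<le> 2 * (d - 2)" by simp
    then show ?thesis by simp
  qed simp
  then have "real (2 ^ Suc (bitlength (d - 2))) \<le> real (2 + 4 * d)" by (simp only: of_nat_le_iff)
  then have "2 powr real (Suc (bitlength (d - 2))) \<le> 2 + 4 * real d"
    by (subst powr_realpow) simp_all
  then show ?thesis by (subst le_log_iff) simp_all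
qed

text \<open>Jensen's inequality for the logarithm, by the tangent at the mean a.\<close>

lemma sum_bitlength_le_log:
  assumes n: "1 \<le> n" and deg: "(\<Sum>v \<in> {1..n}. d v) = 2 * m"
  shows "real n + real (\<Sum>v \<in> {1..n}. bitlength (d v - 2)) \<le> real n * log 2 (2 + 8 * real m / real n)"
proof -
  define a where "a = 2 + 8 * real m / real n"
  have a: "0 < a" by (simp add: a_def add_pos_nonneg)
  have tangent: "log 2 x \<le> log 2 a + (x / a - 1) / ln 2" if "0 < x" for x
  proof -
    have "ln (x / a) \<le> x / a - 1" using that a by (intro ln_le_minus_one) simp
    then have "ln x - ln a \<le> x / a - 1" using that a by (simp add: ln_div)
    then have "(ln x - ln a) / ln 2 \<le> (x / a - 1) / ln 2" by (intro divide_right_mono) simp_all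
    then show ?thesis by (simp add: log_def diff_divide_distrib)
  qed
  have "real n + real (\<Sum>v \<in> {1..n}. bitlength (d v - 2)) = (\<Sum>v \<in> {1..n}. real (Suc (bitlength (d v - 2))))"
    by (simp add: sum.distrib)
  also have "\<dots> \<le> (\<Sum>v \<in> {1..n}. log 2 a + ((2 + 4 * real (d v)) / a - 1) / ln 2)"
    by (intro sum_mono order_trans[OF Suc_bitlength_le_log tangent]) simp
  also have "\<dots> = real n * log 2 a + ((\<Sum>v \<in> {1..n}. 2 + 4 * real (d v)) / a - real n) / ln 2"
    by (simp only: sum.distrib sum_divide_distrib[symmetric] sum_subtractf) simp
  also have "(\<Sum>v \<in> {1..n}. 2 + 4 * real (d v)) = 2 * real n + 4 * real (\<Sum>v \<in> {1..n}. d v)"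
    by (simp add: sum.distrib sum_distrib_left)
  also have "\<dots> = real n * a" using n deg by (simp add: a_def field_simps)
  finally show ?thesis using a by (simp add: a_def)
qed

lemma bitlength_le_log: "1 \<le> n \<Longrightarrow> real (bitlength n) \<le> 2 * log 2 (real n + 1)"
proof -
  assume n: "1 \<le> n"
  then have "2 ^ (bitlength n - 1) \<le> n" by (intro power_bitlength_le) simp
  moreover have "bitlength n = Suc (bitlength n - 1)" using n bitlength_pos[of n] by simp
  ultimately have "2 ^ bitlength n \<le> 2 * n" by (metis mult_le_mono2 power_Suc)
  also have "\<dots> \<le> (n + 1) ^ 2" by (simp add: power2_eq_square)
  finally have "real (2 ^ bitlength n) \<le> real ((n + 1) ^ 2)" by (simp only: of_nat_le_iff)
  then have "2 powr real (bitlength n) \<le> (real n + 1) ^ 2"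
    by (simp add: powr_realpow add.commute)
  then have "real (bitlength n) \<le> log 2 ((real n + 1) ^ 2)" by (subst le_log_iff) simp_all
  also have "\<dots> = 2 * log 2 (real n + 1)" by (subst log_nat_power) simp_all
  finally show ?thesis .
qed

text \<open>With degree sum 2m, the time is at most 6 + 30(12m + 12n), and \<open>1 \<le> n\<close>
  absorbs the 6 into 366(n + m). In space, 145 = 18 * 8 + 1: 18 registers of at most
  \<open>8 * log 2 (real n + 1)\<close> bits each, and the additional bit of a root.\<close>

lemma (in adjacency) dfs_program_carries_out_DFS:
  assumes I: "size_of I = n" "access I = array_access n opp A"
    and opp: "opp so = si" "opp si = so"
    and m: "(\<Sum>v \<in> {1..n}. dg v) = 2 * m"
    and w: "8 * log 2 (real n + 1) \<le> real w"
    and S: "real n + real (\<Sum>v \<in> {1..n}. bitlength (dg v - 2)) \<le> S"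
  shows "carries_out_DFS (dfs_program so si dir) w I adj
    (366 * (real n + real m)) (S + 145 * log 2 (real n + 1))"
proof -
  define L where "L = (\<Sum>v \<in> {1..n}. bitlength (dg v - 2))"
  \<comment> \<open>Then \<open>2 ^ R\<close> is at least the fourth power of n + 1, enough for all
    addresses by the crude bound \<open>L \<le> 2 * (n * n)\<close>.\<close>
  define R where "R = 4 * bitlength n"
  define M where "M = \<lparr>word_length = w, mem_words = n + L + 1, mem_bits = 1, reg_bits = R\<rparr>"
  have log_ge_1: "1 \<le> log 2 (real n + 1)" using size_pos by (subst le_log_iff) simp_all
  have R: "real R \<le> 8 * log 2 (real n + 1)"
    using bitlength_le_log[OF size_pos] by (simp add: R_def)
  then have R_w: "R \<le> w" using w by linarith
  have "(n + 1) ^ 4 \<le> (2 ^ bitlength n) ^ 4"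
    using less_power_bitlength[of n] by (intro power_mono) simp_all
  then have "(n + 1) ^ 4 \<le> 2 ^ R" by (simp add: R_def power_mult mult.commute)
  moreover have "4 * ((n + 1) * (n + 1)) \<le> (n + 1) ^ 4"
  proof -
    have "2 * 2 \<le> (n + 1) * (n + 1)" using size_pos by (intro mult_le_mono) simp_all
    then have "4 * ((n + 1) * (n + 1)) \<le> ((n + 1) * (n + 1)) * ((n + 1) * (n + 1))"
      by (intro mult_le_mono1) simp
    then show ?thesis by (simp only: power4_eq_xxxx mult.assoc)
  qed
  ultimately have big: "4 * ((n + 1) * (n + 1)) \<le> 2 ^ R" by linarith
  have "L \<le> (\<Sum>v \<in> {1..n}. 2 * n)"
    unfolding L_def
  proof (rule sum_mono)
    fix v assume "v \<in> {1..n}"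
    then show "bitlength (dg v - 2) \<le> 2 * n"
      using bitlength_le[of "dg v - 2"] dg_le[of v] by simp
  qed
  then have L: "L \<le> 2 * (n * n)" by simp
  have words: "n + L + 1 < 2 ^ R" "2 * n + 4 \<le> 2 ^ R"
    using big L size_pos by (simp_all add: algebra_simps)
  interpret dfs_machine n A so si dir M I opp
    by unfold_locales (use R_w words I opp in \<open>simp_all add: M_def L_def\<close>)
  obtain es t s where run: "exec M I (dfs_program so si dir) initial_state es t s"
    and "is_DFS n adj es" "t \<le> 6 + 30 * ((\<Sum>v \<in> {1..n}. white_cost v) + 2 * n)"
    using wp_dfs_program unfolding wp_def by auto
  moreover have "(\<Sum>v \<in> {1..n}. white_cost v) = 12 * m + 10 * n"
    unfolding white_cost_def using m by (simp add: sum.distrib sum_distrib_left[symmetric])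
  ultimately have "is_DFS (size_of I) adj es" "real t \<le> 366 * (real n + real m)"
    using I(1) size_pos by auto
  moreover have "real (working_bits M (dfs_program so si dir)) \<le> S + 145 * log 2 (real n + 1)"
  proof -
    have "card (registers (dfs_program so si dir)) \<le> card {..17::nat}"
      using registers_dfs_program by (rule card_mono[OF finite_atMost])
    then have "card (registers (dfs_program so si dir)) * R \<le> 18 * R"
      by (intro mult_le_mono1) simp
    then have "working_bits M (dfs_program so si dir) \<le> n + L + 1 + 18 * R"
      by (simp add: working_bits_def M_def)
    then have "real (working_bits M (dfs_program so si dir)) \<le> real (n + L + 1 + 18 * R)"
      by (simp only: of_nat_le_iff)
    also have "\<dots> = (real n + real L) + 1 + 18 * real R" by simp
    also have "\<dots> \<le> S + 145 * log 2 (real n + 1)"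
      using R log_ge_1 S[folded L_def] by linarith
    finally show ?thesis .
  qed
  moreover have "word_length M = w" by (simp add: M_def)
  ultimately show ?thesis unfolding carries_out_DFS_def using run by blast
qed

section \<open>Degree sums, and the instances for undirected and directed graphs\<close>

lemma undirected_graph_finite: "undirected_graph n E \<Longrightarrow> finite E"
  by (rule finite_subset[of _ "Pow {1..n}"]) (auto simp: undirected_graph_def)

lemma undirected_degree_neighbours:
  assumes "undirected_graph n E"
  shows "undirected_degree E v = card {w. {v, w} \<in> E}"
proof -
  have "bij_betw (\<lambda>w. {v, w}) {w. {v, w} \<in> E} {e \<in> E. v \<in> e}"
    unfolding bij_betw_def
  proof
    show "inj_on (\<lambda>w. {v, w}) {w. {v, w} \<in> E}" by (auto simp: inj_on_def doubleton_eq_iff)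
    have "\<exists>w. e = {v, w}" if "e \<in> E" "v \<in> e" for e
    proof -
      have "card e = 2" using assms that(1) by (auto simp: undirected_graph_def)
      with that(2) show ?thesis by (auto simp: card_2_iff)
    qed
    then show "(\<lambda>w. {v, w}) ` {w. {v, w} \<in> E} = {e \<in> E. v \<in> e}" by auto
  qed
  then show ?thesis by (simp add: undirected_degree_def bij_betw_same_card)
qed

lemma sum_undirected_degree:
  assumes "undirected_graph n E"
  shows "(\<Sum>v \<in> {1..n}. undirected_degree E v) = 2 * card E"
  unfolding undirected_degree_def
proof (rule sum_multicount)
  show "\<forall>e \<in> E. card {v \<in> {1..n}. v \<in> e} = 2"
  proof
    fix e assume "e \<in> E"
    with assms have "e \<subseteq> {1..n}" "card e = 2" by (auto simp: undirected_graph_def)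
    moreover from this have "{v \<in> {1..n}. v \<in> e} = e" by auto
    ultimately show "card {v \<in> {1..n}. v \<in> e} = 2" by simp
  qed
qed (use undirected_graph_finite[OF assms] in auto)

lemma sum_total_degree:
  assumes "directed_graph n E"
  shows "(\<Sum>v \<in> {1..n}. total_degree E v) = 2 * card E"
proof -
  have sub: "E \<subseteq> {1..n} \<times> {1..n}" using assms by (simp add: directed_graph_def)
  have out: "(\<Sum>v \<in> {1..n}. card {u. (v, u) \<in> F}) = card F" if "F \<subseteq> {1..n} \<times> {1..n}" for F
  proof -
    have "finite {u. (v, u) \<in> F}" for v
      by (rule finite_subset[of _ "{1..n}"]) (use that in auto)
    then have "card (SIGMA v:{1..n}. {u. (v, u) \<in> F}) = (\<Sum>v \<in> {1..n}. card {u. (v, u) \<in> F})"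
      by (intro card_SigmaI) auto
    moreover have "(SIGMA v:{1..n}. {u. (v, u) \<in> F}) = F" using that by auto
    ultimately show ?thesis by simp
  qed
  \<comment> \<open>Indegrees are the outdegrees of the converse graph.\<close>
  have "(\<Sum>v \<in> {1..n}. card {u. (u, v) \<in> E}) = card (E\<inverse>)"
    using out[of "E\<inverse>"] sub by auto
  then show ?thesis unfolding total_degree_def using out[OF sub]
    by (simp add: sum.distrib card_inverse)
qed

text \<open>All three bounds come from the same program: it remains to compare the number of marks
  and counter bits with \<open>S\<close>.\<close>

lemma undirected_DFS_in_spaceI:
  assumes "\<And>n E. undirected_graph n E \<Longrightarrow>
    real n + real (\<Sum>v \<in> {1..n}. bitlength (undirected_degree E v - 2)) \<le> S n E"
  shows "undirected_DFS_in_space S"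
  unfolding undirected_DFS_in_space_def
proof (intro exI allI impI)
  fix n E adj w
  assume E: "undirected_graph n E" and adj: "undirected_arrays n E adj"
    and w: "8 * log 2 (real n + 1) \<le> real w"
  have set_adj: "distinct (adj u)" "set (adj u) = {v. {u, v} \<in> E}" if "u \<in> {1..n}" for u
    using adj that by (auto simp: undirected_arrays_def)
  interpret adjacency n "\<lambda>_. adj" "()" "()" False
    by unfold_locales (use E set_adj in \<open>auto simp: undirected_graph_def insert_commute\<close>)
  have deg: "dg v = undirected_degree E v" if "v \<in> {1..n}" for v
    using set_adj[OF that] distinct_card[of "adj v"]
    by (simp add: dg_def offset_def undirected_degree_neighbours[OF E])
  show "carries_out_DFS (dfs_program () () False) w (undirected_input n adj) adj
      (366 * (real n + real (card E))) (S n E + 145 * log 2 (real n + 1))"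
  proof (rule dfs_program_carries_out_DFS[where opp = id])
    show "(\<Sum>v \<in> {1..n}. dg v) = 2 * card E"
      using sum_undirected_degree[OF E] deg by simp
    show "real n + real (\<Sum>v \<in> {1..n}. bitlength (dg v - 2)) \<le> S n E"
      using assms[OF E] deg by simp
  qed (use w in \<open>simp_all add: undirected_input_def\<close>)
qed

lemma directed_DFS_in_spaceI:
  assumes "\<And>n E. directed_graph n E \<Longrightarrow>
    real n + real (\<Sum>v \<in> {1..n}. bitlength (total_degree E v - 2)) \<le> S n E"
  shows "directed_DFS_in_space S"
  unfolding directed_DFS_in_space_def
proof (intro exI allI impI)
  fix n E A w
  assume E: "directed_graph n E" and A: "directed_arrays n E A"
    and w: "8 * log 2 (real n + 1) \<le> real w"
  have arrays: "distinct (A Out u)" "set (A Out u) = {v. (u, v) \<in> E}"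
    "distinct (A In u)" "set (A In u) = {v. (v, u) \<in> E}" if "u \<in> {1..n}" for u
    using A that by (auto simp: directed_arrays_def)
  interpret adjacency n A Out In True
    by unfold_locales (use E arrays in \<open>auto simp: directed_graph_def\<close>)
  have deg: "dg v = total_degree E v" if "v \<in> {1..n}" for v
    using arrays[OF that] distinct_card[of "A Out v"] distinct_card[of "A In v"]
    by (simp add: dg_def offset_def total_degree_def)
  show "carries_out_DFS (dfs_program Out In True) w (directed_input n A) (A Out)
      (366 * (real n + real (card E))) (S n E + 145 * log 2 (real n + 1))"
  proof (rule dfs_program_carries_out_DFS[where opp = opposite])
    show "(\<Sum>v \<in> {1..n}. dg v) = 2 * card E"
      using sum_total_degree[OF E] deg by simp
    show "real n + real (\<Sum>v \<in> {1..n}. bitlength (dg v - 2)) \<le> S n E"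
      using assms[OF E] deg by simp
  qed (use w in \<open>simp_all add: directed_input_def\<close>)
qed

theorem theorem4p1:
  shows
    "(undirected_DFS_in_space (\<lambda>n E. real n + real_of_int (L_minus_1 n (undirected_degree E))) \<and>
      directed_DFS_in_space (\<lambda>n E. real n + real_of_int (L_minus_1 n (total_degree E)))) \<and>
     (undirected_DFS_in_space (\<lambda>n E. real n + real (card E)) \<and>
      directed_DFS_in_space (\<lambda>n E. real n + real (card E))) \<and>
     (undirected_DFS_in_space (\<lambda>n E. real n * log 2 (2 + 8 * real (card E) / real n)) \<and>
      directed_DFS_in_space (\<lambda>n E. real n * log 2 (2 + 8 * real (card E) / real n)))"
proof (intro conjI undirected_DFS_in_spaceI directed_DFS_in_spaceI)
  fix n :: nat and E :: "nat set set"
  assume E: "undirected_graph n E"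
  then have n: "1 \<le> n" by (simp add: undirected_graph_def)
  show "real n + real (\<Sum>v \<in> {1..n}. bitlength (undirected_degree E v - 2))
      \<le> real n + real_of_int (L_minus_1 n (undirected_degree E))"
    by (simp add: L_minus_1_eq)
  show "real n + real (\<Sum>v \<in> {1..n}. bitlength (undirected_degree E v - 2)) \<le> real n + real (card E)"
    using sum_bitlength_le_edges[OF sum_undirected_degree[OF E]] by (simp only: of_nat_le_iff add_le_cancel_left)
  show "real n + real (\<Sum>v \<in> {1..n}. bitlength (undirected_degree E v - 2))
      \<le> real n * log 2 (2 + 8 * real (card E) / real n)"
    by (rule sum_bitlength_le_log[OF n sum_undirected_degree[OF E]])
next
  fix n :: nat and E :: "(nat \<times> nat) set"
  assume E: "directed_graph n E"
  then have n: "1 \<le> n" by (simp add: directed_graph_def)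
  show "real n + real (\<Sum>v \<in> {1..n}. bitlength (total_degree E v - 2))
      \<le> real n + real_of_int (L_minus_1 n (total_degree E))"
    by (simp add: L_minus_1_eq)
  show "real n + real (\<Sum>v \<in> {1..n}. bitlength (total_degree E v - 2)) \<le> real n + real (card E)"
    using sum_bitlength_le_edges[OF sum_total_degree[OF E]] by (simp only: of_nat_le_iff add_le_cancel_left)
  show "real n + real (\<Sum>v \<in> {1..n}. bitlength (total_degree E v - 2))
      \<le> real n * log 2 (2 + 8 * real (card E) / real n)"
    by (rule sum_bitlength_le_log[OF n sum_total_degree[OF E]])
qed

end
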